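(* Consider the maps $f\colon\mathbb{R}^2\to S^3\subset\mathbb{R}^4$ defined by $$f(x,y)=\bigl(r\cos(ax+by),\,r\sin(ax+by),\,s\cos(cx+dy),\,s\sin(cx+dy)\bigr),\qquad(\ast)$$ where $r,s$ are non-zero real constants with $r^2+s^2=1$ and $$a=\tfrac{2}{r}\sinh\phi\cos\theta,\quad b=-\tfrac2r\cosh\phi\sin\theta,\quad c=\tfrac2s\sinh\phi\sin\theta,\quad d=\tfrac2s\cosh\phi\cos\theta$$ for some real constants $\phi>0$ and $\theta$ related by $\theta=\tfrac12\arccos\bigl((s^2-r^2)\cosh2\phi\bigr)$ (in particular $|(s^2-r^2)\cosh 2\phi|\le 1$). These maps are non-conformal harmonic maps with adapted coordinate $z=x+iy$, and the constant $\phi$ is the function $\phi$ associated to $f$; in particular $\langle f_x,f_x\rangle=4\sinh^2\phi$ and $\langle f_y,f_y\rangle=4\cosh^2\phi$ are constant. The function $\mu$ associated to $f$ is also constant, namely $$\mu=\frac{\sinh2\phi}{2rs}\Bigl((r^2-s^2)\sinh2\phi-i\sqrt{1-(r^2-s^2)^2\cosh^22\phi}\Bigr).$$ Moreover, these maps are congruent to their $\epsilon$-transforms ($\epsilon=\pm1$), and, conversely, every non-conformal harmonic map congruent to its $\epsilon$-transform is, in an adapted coordinate $z=x+iy$ and up to an isometry of $S^3$, of the form $(\ast)$.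
   Context: Identify $\mathbb{R}^4$ with the quaternions $\mathbb{H}$ (basis $1,e_1,e_2,e_3$ with $e_1^2=e_2^2=e_3^2=e_1e_2e_3=-1$), $\mathbb{R}^3$ with the imaginary quaternions $\operatorname{Im}\mathbb{H}$, and $S^3$ with the unit quaternions. $\langle\,,\rangle$ and $\times$ denote the Euclidean inner product and the vector product of $\mathbb{R}^3$, extended complex-bilinearly to complexified vectors. For a complex coordinate $z=x+iy$ write $\partial=\partial/\partial z$, $\bar\partial=\partial/\partial\bar z$. A smooth map $f\colon S\to S^3\subset\mathbb{R}^4$ from a (connected) Riemann surface is harmonic if $\partial\bar\partial f=-|\partial f|^2 f$, where $|\partial f|^2=\langle\partial f,\bar\partial f\rangle$. The map is called non-conformal if $\langle \partial f,\partial f\rangle\neq 0$; then there are complex coordinates $z$ with $\langle\partial f,\partial f\rangle=-1$, called adapted complex coordinates for $f$. Standing convention: an adapted coordinate $z=x+iy$ is fixed on $S$, and it is used for all constructions. Define $\operatorname{Im}\mathbb{H}$-valued functions $\alpha,\beta$ by $f_x=f\alpha$, $f_y=f\beta$ (quaternion product). Adaptedness gives $\langle\alpha,\beta\rangle=0$ and a non-negative function $\phi$ with $|\alpha|=2\sinh\phi$, $|\beta|=2\cosh\phi$. Standing assumption: $\alpha\neq 0$, i.e. $\phi>0$, on $S$. Put $N=\tfrac{1}{2}\operatorname{csch}(2\phi)\, f(\alpha\times\beta)$ (the unit normal, for which $\{f,f_x,f_y,N\}$ is positively oriented) and $\mu=\langle\partial\partial f,N\rangle$. For $\epsilon=\pm1$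 the $\epsilon$-transform of $f$ is the map into $S^3$ $$f^{\epsilon}=\tfrac{\epsilon i}{2}\operatorname{sech}^2\phi\,(\partial f-\bar\partial f)+\tanh\phi\,N=\tfrac12\operatorname{sech}^2\phi\; f\bigl(\epsilon\beta+\tfrac12\,\alpha\times\beta\bigr).$$ Two maps $f,g\colon S\to S^3$ are congruent if $g=R\circ f$ for some isometry $R\in O(4)$ of $S^3$. *)

theory Defs
  imports "HOL-Analysis.Analysis"
begin

section \<open>Quaternions as real 4-vectors\<close>

text \<open>
  The coordinates of \<^typ>\<open>real^4\<close> are taken with respect to the basis
  $1, e_1, e_2, e_3$ of the quaternions; \<^typ>\<open>real^3\<close> is identified with the
  imaginary quaternions through \<open>imq\<close>.
\<close>

definition qmult :: "real^4 \<Rightarrow> real^4 \<Rightarrow> real^4"  (infixl \<open>\<odot>\<close> 70) where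
  "p \<odot> q = vector
     [p$1 * q$1 - p$2 * q$2 - p$3 * q$3 - p$4 * q$4,
      p$1 * q$2 + p$2 * q$1 + p$3 * q$4 - p$4 * q$3,
      p$1 * q$3 - p$2 * q$4 + p$3 * q$1 + p$4 * q$2,
      p$1 * q$4 + p$2 * q$3 - p$3 * q$2 + p$4 * q$1]"

definition imq :: "real^3 \<Rightarrow> real^4" where
  "imq v = vector [0, v$1, v$2, v$3]"

lemma vector_4_nth [simp]:
  "(vector [w,x,y,z] :: ('a::zero)^4)$1 = w"
  "(vector [w,x,y,z] :: ('a::zero)^4)$2 = x"
  "(vector [w,x,y,z] :: ('a::zero)^4)$3 = y"
  "(vector [w,x,y,z] :: ('a::zero)^4)$4 = z"
  by (simp_all add: vector_def)

lemma quaternion_relations: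
  fixes one e1 e2 e3 :: "real^4"
  defines "one \<equiv> axis 1 1" and "e1 \<equiv> axis 2 1" and "e2 \<equiv> axis 3 1" and "e3 \<equiv> axis 4 1"
  shows "one \<odot> q = q" "q \<odot> one = q"
    and "e1 \<odot> e1 = - one" "e2 \<odot> e2 = - one" "e3 \<odot> e3 = - one" "e1 \<odot> e2 \<odot> e3 = - one"
    and "(p \<odot> q) \<odot> r = p \<odot> (q \<odot> r)"
  by (simp_all add: assms qmult_def vec_eq_iff forall_4 axis_def algebra_simps)


section \<open>Complexified vectors\<close>

definition cvec :: "real^'n \<Rightarrow> complex^'n" where
  "cvec v = (\<chi> i. complex_of_real (v$i))"

text \<open>The complex-bilinear (not Hermitian) extension of the Euclidean inner product.\<close>

definition cbilin :: "complex^'n \<Rightarrow> complex^'n \<Rightarrow> complex" where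
  "cbilin u v = (\<Sum>i\<in>UNIV. u$i * v$i)"


section \<open>Riemann surfaces with a fixed complex coordinate\<close>

text \<open>
  A Riemann surface with a complex coordinate fixed on it is given by a connected
  Hausdorff space \<open>S\<close> and a local homeomorphism \<open>z\<close> from \<open>S\<close> to the complex plane. The complex
  structure of \<open>S\<close> is the one for which \<open>z\<close> is a local coordinate near every point, so it need
  not be recorded separately. The function \<open>z\<close> is not required to be injective; if it is,
  then \<open>S\<close> is a domain in the plane.
\<close>

definition coord_inverse_on ::
  "'a::t2_space set \<Rightarrow> ('a \<Rightarrow> complex) \<Rightarrow> 'a set \<Rightarrow> (complex \<Rightarrow> 'a) \<Rightarrow> bool" where
  "coord_inverse_on S z V h \<longleftrightarrow>
     openin (top_of_set S) V \<and> open (z ` V) \<and> homeomorphism V (z ` V) z h"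

definition complex_coordinate :: "'a::t2_space set \<Rightarrow> ('a \<Rightarrow> complex) \<Rightarrow> bool" where
  "complex_coordinate S z \<longleftrightarrow> (\<forall>p\<in>S. \<exists>V h. p \<in> V \<and> coord_inverse_on S z V h)"

text \<open>
  A local inverse of \<open>z\<close> near \<open>p\<close>. Any two choices agree in a neighbourhood of \<open>z p\<close>, so the
  derivatives defined from it do not depend on the choice.
\<close>

definition coord_inverse :: "'a::t2_space set \<Rightarrow> ('a \<Rightarrow> complex) \<Rightarrow> 'a \<Rightarrow> complex \<Rightarrow> 'a" where
  "coord_inverse S z p = (SOME h. \<exists>V. p \<in> V \<and> coord_inverse_on S z V h)"

text \<open>The partial derivatives $g_x$ and $g_y$ with respect to $z = x + iy$.\<close>

definition dx :: "'a::t2_space set \<Rightarrow> ('a \<Rightarrow> complex) \<Rightarrow> ('a \<Rightarrow> 'b::real_normed_vector) \<Rightarrow> 'a \<Rightarrow> 'b" where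
  "dx S z g p =
     vector_derivative (\<lambda>t. g (coord_inverse S z p (z p + complex_of_real t))) (at 0)"

definition dy :: "'a::t2_space set \<Rightarrow> ('a \<Rightarrow> complex) \<Rightarrow> ('a \<Rightarrow> 'b::real_normed_vector) \<Rightarrow> 'a \<Rightarrow> 'b" where
  "dy S z g p =
     vector_derivative (\<lambda>t. g (coord_inverse S z p (z p + \<i> * complex_of_real t))) (at 0)"

text \<open>The Wirtinger derivatives $\partial g$ and $\bar\partial g$.\<close>

definition dz :: "'a::t2_space set \<Rightarrow> ('a \<Rightarrow> complex) \<Rightarrow> ('a \<Rightarrow> complex^'n) \<Rightarrow> 'a \<Rightarrow> complex^'n" where
  "dz S z g p = (1/2) *s (dx S z g p - \<i> *s dy S z g p)"

definition dzbar :: "'a::t2_space set \<Rightarrow> ('a \<Rightarrow> complex) \<Rightarrow> ('a \<Rightarrow> complex^'n) \<Rightarrow> 'a \<Rightarrow> complex^'n" where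
  "dzbar S z g p = (1/2) *s (dx S z g p + \<i> *s dy S z g p)"

primrec Ck_map :: "nat \<Rightarrow> 'a::t2_space set \<Rightarrow> ('a \<Rightarrow> complex) \<Rightarrow>
    ('a \<Rightarrow> 'b::real_normed_vector) \<Rightarrow> bool" where
  "Ck_map 0 S z = (\<lambda>g. continuous_on S g)"
| "Ck_map (Suc k) S z = (\<lambda>g.
     (\<forall>p\<in>S. (\<lambda>w. g (coord_inverse S z p w)) differentiable (at (z p))) \<and>
     Ck_map k S z (dx S z g) \<and> Ck_map k S z (dy S z g))"

definition smooth_map ::
  "'a::t2_space set \<Rightarrow> ('a \<Rightarrow> complex) \<Rightarrow> ('a \<Rightarrow> 'b::real_normed_vector) \<Rightarrow> bool" where
  "smooth_map S z g \<longleftrightarrow> (\<forall>k. Ck_map k S z g)"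


section \<open>Harmonic maps into the 3-sphere\<close>

abbreviation del :: "'a::t2_space set \<Rightarrow> ('a \<Rightarrow> complex) \<Rightarrow> ('a \<Rightarrow> real^'n) \<Rightarrow> 'a \<Rightarrow> complex^'n" where
  "del S z f \<equiv> dz S z (\<lambda>p. cvec (f p))"

abbreviation delbar :: "'a::t2_space set \<Rightarrow> ('a \<Rightarrow> complex) \<Rightarrow> ('a \<Rightarrow> real^'n) \<Rightarrow> 'a \<Rightarrow> complex^'n" where
  "delbar S z f \<equiv> dzbar S z (\<lambda>p. cvec (f p))"

definition harmonic_map :: "'a::t2_space set \<Rightarrow> ('a \<Rightarrow> complex) \<Rightarrow> ('a \<Rightarrow> real^4) \<Rightarrow> bool" where
  "harmonic_map S z f \<longleftrightarrow>
     smooth_map S z f \<and> f ` S \<subseteq> sphere 0 1 \<and>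
     (\<forall>p\<in>S. dz S z (delbar S z f) p
              = - (cbilin (del S z f p) (delbar S z f p) *s cvec (f p)))"

definition non_conformal :: "'a::t2_space set \<Rightarrow> ('a \<Rightarrow> complex) \<Rightarrow> ('a \<Rightarrow> real^4) \<Rightarrow> bool" where
  "non_conformal S z f \<longleftrightarrow> (\<forall>p\<in>S. cbilin (del S z f p) (del S z f p) \<noteq> 0)"

definition adapted_coordinate :: "'a::t2_space set \<Rightarrow> ('a \<Rightarrow> complex) \<Rightarrow> ('a \<Rightarrow> real^4) \<Rightarrow> bool" where
  "adapted_coordinate S z f \<longleftrightarrow> (\<forall>p\<in>S. cbilin (del S z f p) (del S z f p) = -1)"

definition alpha_of :: "'a::t2_space set \<Rightarrow> ('a \<Rightarrow> complex) \<Rightarrow> ('a \<Rightarrow> real^4) \<Rightarrow> 'a \<Rightarrow> real^3" where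
  "alpha_of S z f p = (THE a. dx S z f p = f p \<odot> imq a)"

definition beta_of :: "'a::t2_space set \<Rightarrow> ('a \<Rightarrow> complex) \<Rightarrow> ('a \<Rightarrow> real^4) \<Rightarrow> 'a \<Rightarrow> real^3" where
  "beta_of S z f p = (THE b. dy S z f p = f p \<odot> imq b)"

definition phi_of :: "'a::t2_space set \<Rightarrow> ('a \<Rightarrow> complex) \<Rightarrow> ('a \<Rightarrow> real^4) \<Rightarrow> 'a \<Rightarrow> real" where
  "phi_of S z f p = (THE t. 0 \<le> t \<and>
     norm (alpha_of S z f p) = 2 * sinh t \<and> norm (beta_of S z f p) = 2 * cosh t)"

definition normal_of :: "'a::t2_space set \<Rightarrow> ('a \<Rightarrow> complex) \<Rightarrow> ('a \<Rightarrow> real^4) \<Rightarrow> 'a \<Rightarrow> real^4" where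
  "normal_of S z f p = (1 / (2 * sinh (2 * phi_of S z f p))) *\<^sub>R
     (f p \<odot> imq (cross3 (alpha_of S z f p) (beta_of S z f p)))"

definition mu_of :: "'a::t2_space set \<Rightarrow> ('a \<Rightarrow> complex) \<Rightarrow> ('a \<Rightarrow> real^4) \<Rightarrow> 'a \<Rightarrow> complex" where
  "mu_of S z f p = cbilin (dz S z (del S z f) p) (cvec (normal_of S z f p))"

definition eps_transform ::
  "real \<Rightarrow> 'a::t2_space set \<Rightarrow> ('a \<Rightarrow> complex) \<Rightarrow> ('a \<Rightarrow> real^4) \<Rightarrow> 'a \<Rightarrow> real^4" where
  "eps_transform \<epsilon> S z f p = (1 / (2 * (cosh (phi_of S z f p))\<^sup>2)) *\<^sub>R
     (f p \<odot> imq (\<epsilon> *\<^sub>R beta_of S z f p +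
                (1/2) *\<^sub>R cross3 (alpha_of S z f p) (beta_of S z f p)))"

definition congruent_maps :: "'a set \<Rightarrow> ('a \<Rightarrow> real^4) \<Rightarrow> ('a \<Rightarrow> real^4) \<Rightarrow> bool" where
  "congruent_maps S f g \<longleftrightarrow> (\<exists>R. orthogonal_transformation R \<and> (\<forall>p\<in>S. g p = R (f p)))"

text \<open>
  The \<open>\<epsilon>\<close>-transform in terms of $\partial f$, $\bar\partial f$ and the unit normal, at a point
  where $f_y = f\beta$ holds and $\phi \neq 0$.
\<close>

lemma eps_transform_alt:
  fixes f :: "'a::t2_space \<Rightarrow> real^4"
  assumes diff: "(\<lambda>w. f (coord_inverse S z p w)) differentiable (at (z p))"
    and inv: "coord_inverse S z p (z p) = p"
    and beta: "dy S z f p = f p \<odot> imq (beta_of S z f p)"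
    and phi: "phi_of S z f p \<noteq> 0"
  shows "cvec (eps_transform \<epsilon> S z f p) =
     (\<epsilon> * \<i> / 2 * (1 / cosh (phi_of S z f p))\<^sup>2) *s (del S z f p - delbar S z f p)
     + complex_of_real (tanh (phi_of S z f p)) *s cvec (normal_of S z f p)"
proof -
  let ?g = "\<lambda>t. f (coord_inverse S z p (z p + \<i> * complex_of_real t))"
  have lin: "bounded_linear (cvec :: real^4 \<Rightarrow> complex^4)"
    by (rule linear_conv_bounded_linear[THEN iffD1])
       (auto intro!: linearI simp: cvec_def vec_eq_iff scaleR_conv_of_real[where 'a=complex])
  have "(?g has_vector_derivative vector_derivative ?g (at 0)) (at 0)"
  proof -
    have "((\<lambda>w. f (coord_inverse S z p w)) \<circ> (\<lambda>t::real. z p + \<i> * complex_of_real t))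
            differentiable (at 0)"
      by (rule differentiable_chain_at) (use diff in \<open>auto intro!: derivative_intros\<close>)
    then show ?thesis
      by (simp add: o_def vector_derivative_works)
  qed
  from bounded_linear.has_vector_derivative[OF lin this]
  have dyc: "dy S z (\<lambda>p. cvec (f p)) p = cvec (dy S z f p)"
    unfolding dy_def by (rule vector_derivative_at)
  have d: "del S z f p - delbar S z f p = (- \<i>) *s cvec (f p \<odot> imq (beta_of S z f p))"
    by (simp add: dz_def dzbar_def dyc beta[symmetric] vec_eq_iff algebra_simps)
  define t where "t = phi_of S z f p"
  have nz: "sinh t \<noteq> 0" "cosh t \<noteq> 0"
    using phi by (auto simp: t_def)
  have th: "tanh t * (1 / (2 * sinh (2 * t))) = 1 / (2 * (cosh t)\<^sup>2) * (1/2)"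
    unfolding sinh_double using nz by (simp add: tanh_def field_simps power2_eq_square)
  have split: "f p \<odot> imq (a *\<^sub>R u + b *\<^sub>R v) = a *\<^sub>R (f p \<odot> imq u) + b *\<^sub>R (f p \<odot> imq v)" for a b u v
    by (simp add: qmult_def imq_def vec_eq_iff forall_4 algebra_simps)
  show ?thesis
    unfolding d eps_transform_def split normal_of_def t_def[symmetric] vec_eq_iff
  proof
    fix i :: 4
    let ?v = "(f p \<odot> imq (cross3 (alpha_of S z f p) (beta_of S z f p))) $ i"
    have "complex_of_real (tanh t) * (complex_of_real (1 / (2 * sinh (2 * t))) * ?v)
        = complex_of_real (1 / (2 * (cosh t)\<^sup>2) * (1/2) * ?v)"
      by (simp only: th[symmetric] of_real_mult mult.assoc)
    then show "cvec ((1 / (2 * (cosh t)\<^sup>2)) *\<^sub>R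
          (\<epsilon> *\<^sub>R (f p \<odot> imq (beta_of S z f p)) +
           (1/2) *\<^sub>R (f p \<odot> imq (cross3 (alpha_of S z f p) (beta_of S z f p))))) $ i =
        ((\<epsilon> * \<i> / 2 * (1 / cosh t)\<^sup>2) *s ((- \<i>) *s cvec (f p \<odot> imq (beta_of S z f p)))
        + complex_of_real (tanh t) *s cvec ((1 / (2 * sinh (2 * t))) *\<^sub>R
            (f p \<odot> imq (cross3 (alpha_of S z f p) (beta_of S z f p))))) $ i"
      by (simp add: cvec_def algebra_simps power_divide)
  qed
qed


section \<open>The explicit family\<close>

definition admissible :: "real \<Rightarrow> real \<Rightarrow> real \<Rightarrow> real \<Rightarrow> bool" where
  "admissible r s \<phi> \<theta> \<longleftrightarrow>
     r \<noteq> 0 \<and> s \<noteq> 0 \<and> r\<^sup>2 + s\<^sup>2 = 1 \<and> \<phi> > 0 \<and>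
     \<bar>(s\<^sup>2 - r\<^sup>2) * cosh (2 * \<phi>)\<bar> \<le> 1 \<and>
     \<theta> = arccos ((s\<^sup>2 - r\<^sup>2) * cosh (2 * \<phi>)) / 2"

definition torus_map :: "real \<Rightarrow> real \<Rightarrow> real \<Rightarrow> real \<Rightarrow> complex \<Rightarrow> real^4" where
  "torus_map r s \<phi> \<theta> w =
     (let x = Re w; y = Im w;
          a = 2 / r * sinh \<phi> * cos \<theta>;
          b = - (2 / r) * cosh \<phi> * sin \<theta>;
          c = 2 / s * sinh \<phi> * sin \<theta>;
          d = 2 / s * cosh \<phi> * cos \<theta>
      in vector [r * cos (a * x + b * y), r * sin (a * x + b * y),
                 s * cos (c * x + d * y), s * sin (c * x + d * y)])"

end

theory Submission
  imports Defs
begin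

text \<open>
  Suppose $f^\epsilon = R f$ with $R$ orthogonal. The transform is orthogonal to $f$ and $f_x$ and
  has inner product $2\epsilon$ with $f_y$. Differentiating these relations shows that
  $R f - R^{-1} f$ is orthogonal to all second derivatives of $f$. Comparing lengths, at each point either
  $R^{-1} f = - R f$, which forces $R f_x = 0$ and is impossible, or $R f - R^{-1} f$ is a multiple of
  $f_y$. In the latter case the derivatives of $|f_y|^2$ vanish, so $\phi$ is constant, $f_y = Z f$ with a constant
  skew map $Z$, and the normal is $D f$ with a constant symmetric map $D$ commuting with $Z$. This makes
  the coefficients $a$, $b$ of the second fundamental form constant, with
  $a^2 + b^2 = 4\sinh^2 2\phi$ from $|R f_x| = |f_x|$. Some torus map realises
  the same coefficients, and two maps with the same constant structure equations are congruent because the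
  linear map carrying one frame to the other has vanishing derivative.
\<close>


section \<open>Partial derivatives in a complex coordinate\<close>

text \<open>The inner product of R f with f_xx is minus that of R f_x with f_x, a quantity unchanged
  when R is replaced by its inverse; such symmetries put R f - R^{-1} f orthogonal to the second
  derivatives. The two alternatives that follow are separated at each point alone. The remaining
  obstacle is the constancy of a and b. Since f_y = Z f with Z constant, f_xy = Z f_x and f_yy = Z
  f_y, so both coefficients can be differentiated once more. All second derivatives lie in the span
  of f and n, and Z n is orthogonal to both; together with the skewness of Z D this kills every
  term. The identity for a^2 + b^2 is exactly the range of the torus family: for given phi it makes
  the bound |(s^2 - r^2) cosh 2 phi| <= 1 equivalent to b^2 >= 0. Hence only uniqueness for the
  structure equations has to be proved, their solutions being already at hand.\<close>

definition has_partials ::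
  "'a::t2_space set \<Rightarrow> ('a \<Rightarrow> complex) \<Rightarrow> ('a \<Rightarrow> 'b::real_normed_vector) \<Rightarrow> 'a \<Rightarrow> 'b \<Rightarrow> 'b \<Rightarrow> bool" where
  "has_partials S z g p u v \<longleftrightarrow>
     ((\<lambda>w. g (coord_inverse S z p w)) has_derivative (\<lambda>w. Re w *\<^sub>R u + Im w *\<^sub>R v)) (at (z p))"

lemma has_partials_dx: "has_partials S z g p u v \<Longrightarrow> dx S z g p = u"
proof -
  assume "has_partials S z g p u v"
  moreover have "((\<lambda>t::real. z p + complex_of_real t) has_derivative complex_of_real) (at 0)"
    by (auto intro!: derivative_eq_intros)
  ultimately have "((\<lambda>w. g (coord_inverse S z p w)) \<circ> (\<lambda>t::real. z p + complex_of_real t)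
      has_derivative (\<lambda>w. Re w *\<^sub>R u + Im w *\<^sub>R v) \<circ> complex_of_real) (at 0)"
    unfolding has_partials_def by (intro diff_chain_at) auto
  then show ?thesis
    unfolding dx_def by (intro vector_derivative_at) (simp add: has_vector_derivative_def o_def)
qed

lemma has_partials_dy: "has_partials S z g p u v \<Longrightarrow> dy S z g p = v"
proof -
  assume "has_partials S z g p u v"
  moreover have "((\<lambda>t::real. z p + \<i> * complex_of_real t) has_derivative (\<lambda>t. \<i> * complex_of_real t)) (at 0)"
    by (auto intro!: derivative_eq_intros)
  ultimately have "((\<lambda>w. g (coord_inverse S z p w)) \<circ> (\<lambda>t::real. z p + \<i> * complex_of_real t)
      has_derivative (\<lambda>w. Re w *\<^sub>R u + Im w *\<^sub>R v) \<circ> (\<lambda>t. \<i> * complex_of_real t)) (at 0)"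
    unfolding has_partials_def by (intro diff_chain_at) auto
  then show ?thesis
    unfolding dy_def by (intro vector_derivative_at) (simp add: has_vector_derivative_def o_def)
qed

text \<open>A real-linear map on the complex plane is determined by its values at 1 and i.
  \<open>has_partials\<close> records the total derivative, so that the calculus of
  \<open>has_derivative\<close> applies directly.\<close>

lemma differentiable_has_partials:
  assumes "(\<lambda>w. g (coord_inverse S z p w)) differentiable (at (z p))"
  shows "has_partials S z g p (dx S z g p) (dy S z g p)"
proof -
  obtain D where D: "((\<lambda>w. g (coord_inverse S z p w)) has_derivative D) (at (z p))"
    using assms by (auto simp: differentiable_def)
  then interpret D: bounded_linear D by (rule has_derivative_bounded_linear)
  have "D = (\<lambda>w. Re w *\<^sub>R D 1 + Im w *\<^sub>R D \<i>)"
  proof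
    fix w
    have "w = Re w *\<^sub>R 1 + Im w *\<^sub>R \<i>"
      by (simp add: complex_eq_iff)
    then show "D w = Re w *\<^sub>R D 1 + Im w *\<^sub>R D \<i>"
      by (metis D.add D.scaleR)
  qed
  then have "has_partials S z g p (D 1) (D \<i>)"
    using D unfolding has_partials_def by argo
  then show ?thesis
    using has_partials_dx has_partials_dy by metis
qed

lemma has_partials_unique:
  "has_partials S z g p a b \<Longrightarrow> has_partials S z g p c d \<Longrightarrow> a = c \<and> b = d"
  by (metis has_partials_dx has_partials_dy)

lemma has_partials_const: "has_partials S z (\<lambda>_. c) p 0 0"
  by (simp add: has_partials_def)

lemma has_partials_linear:
  assumes "bounded_linear A" "has_partials S z g p u v"
  shows "has_partials S z (\<lambda>p. A (g p)) p (A u) (A v)"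
proof -
  interpret bounded_linear A by fact
  show ?thesis
    using has_derivative[OF assms(2)[unfolded has_partials_def]]
    by (simp add: has_partials_def add scaleR)
qed

lemma has_partials_add:
  assumes "has_partials S z g p a b" "has_partials S z h p c d"
  shows "has_partials S z (\<lambda>p. g p + h p) p (a + c) (b + d)"
  using has_derivative_add[OF assms[unfolded has_partials_def]]
  by (simp add: has_partials_def algebra_simps)

lemma has_partials_scaleR:
  "has_partials S z g p a b \<Longrightarrow> has_partials S z (\<lambda>p. c *\<^sub>R g p) p (c *\<^sub>R a) (c *\<^sub>R b)"
  by (rule has_partials_linear[OF bounded_linear_scaleR_right])

lemma has_partials_diff:
  assumes "has_partials S z g p a b" "has_partials S z h p c d"
  shows "has_partials S z (\<lambda>p. g p - h p) p (a - c) (b - d)"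
  using has_partials_add[OF assms(1) has_partials_scaleR[OF assms(2), of "-1"]] by simp

context
  fixes S :: "'a::t2_space set" and z :: "'a \<Rightarrow> complex"
  assumes coord: "complex_coordinate S z"
begin

lemma coord_inverse_on_coord_inverse:
  assumes "p \<in> S"
  obtains V where "p \<in> V" "coord_inverse_on S z V (coord_inverse S z p)"
proof -
  have "\<exists>h V. p \<in> V \<and> coord_inverse_on S z V h"
    using coord assms unfolding complex_coordinate_def by blast
  from someI_ex[OF this] show ?thesis
    using that unfolding coord_inverse_def by blast
qed

lemma coord_inverse_self: "p \<in> S \<Longrightarrow> coord_inverse S z p (z p) = p"
  by (erule coord_inverse_on_coord_inverse) (auto simp: coord_inverse_on_def homeomorphism_def)

lemma coord_inverse_on_eventually:
  assumes "p \<in> V" "coord_inverse_on S z V h"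
  shows "\<forall>\<^sub>F w in nhds (z p). h w \<in> V \<and> z (h w) = w"
proof -
  have "\<forall>\<^sub>F w in nhds (z p). w \<in> z ` V"
    using assms by (intro eventually_nhds_in_open) (auto simp: coord_inverse_on_def)
  then show ?thesis
    by eventually_elim (use assms in \<open>auto simp: coord_inverse_on_def homeomorphism_def\<close>)
qed

lemma coord_inverse_eventually:
  assumes "p \<in> S"
  shows "\<forall>\<^sub>F w in nhds (z p). coord_inverse S z p w \<in> S \<and> z (coord_inverse S z p w) = w"
proof -
  obtain V where V: "p \<in> V" "coord_inverse_on S z V (coord_inverse S z p)"
    using assms by (rule coord_inverse_on_coord_inverse)
  moreover have "V \<subseteq> S"
    using V by (auto simp: coord_inverse_on_def openin_subset dest: openin_imp_subset)
  ultimately show ?thesis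
    using coord_inverse_on_eventually[OF V] by (auto elim!: eventually_mono)
qed

text \<open>\<open>z\<close> is an open map on \<open>V\<close>, so the overlap of \<open>V\<close>
  and \<open>V'\<close> has an open image, on which both inverses send \<open>z q\<close> back to
  \<open>q\<close>. This matters because \<open>coord_inverse\<close> is chosen anew at every
  point.\<close>

lemma coord_inverse_on_eventually_eq:
  assumes "p \<in> V" "coord_inverse_on S z V h" "p \<in> V'" "coord_inverse_on S z V' h'"
  shows "\<forall>\<^sub>F w in nhds (z p). h w = h' w"
proof -
  have op: "openin (top_of_set (z ` V)) (z ` (V \<inter> V'))"
  proof (rule homeomorphism_imp_open_map)
    show "homeomorphism V (z ` V) z h"
      using assms by (simp add: coord_inverse_on_def)
    show "openin (top_of_set V) (V \<inter> V')"
      using assms unfolding coord_inverse_on_def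
      by (metis inf_commute openin_Int openin_subset_trans inf_le1 openin_imp_subset)
  qed
  have "open (z ` (V \<inter> V'))"
    using op assms by (meson coord_inverse_on_def openin_open_trans)
  then have "\<forall>\<^sub>F w in nhds (z p). w \<in> z ` (V \<inter> V')"
    using assms by (intro eventually_nhds_in_open) auto
  then show ?thesis
    by eventually_elim (use assms in \<open>auto simp: coord_inverse_on_def homeomorphism_def\<close>)
qed

text \<open>The local inverse stays in \<open>S\<close> near \<open>z p\<close>, so values outside
  \<open>S\<close> never enter.\<close>

lemma has_partials_transform:
  assumes "has_partials S z g p u v" "p \<in> S" "\<And>q. q \<in> S \<Longrightarrow> g q = h q"
  shows "has_partials S z h p u v"
  unfolding has_partials_def
proof (rule has_derivative_transform_eventually[OF assms(1)[unfolded has_partials_def]])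
  show "\<forall>\<^sub>F w in at (z p). g (coord_inverse S z p w) = h (coord_inverse S z p w)"
    using coord_inverse_eventually[OF assms(2)] assms(3)
    by (auto simp: eventually_at_filter elim!: eventually_mono)
qed (use assms coord_inverse_self in auto)

text \<open>Near \<open>z p\<close> the coordinate undoes its local inverse, so only
  \<open>G\<close> is differentiated. This carries torus maps over to an arbitrary surface.\<close>

lemma has_partials_plane:
  assumes "(G has_derivative (\<lambda>w. Re w *\<^sub>R u + Im w *\<^sub>R v)) (at (z p))" "p \<in> S"
  shows "has_partials S z (\<lambda>p. G (z p)) p u v"
  unfolding has_partials_def
proof (rule has_derivative_transform_eventually[OF assms(1)])
  show "\<forall>\<^sub>F w in at (z p). G w = G (z (coord_inverse S z p w))"
    using coord_inverse_eventually[OF assms(2)]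
    by (auto simp: eventually_at_filter elim!: eventually_mono)
qed (use assms coord_inverse_self in auto)

lemma has_partials_inner:
  assumes "has_partials S z g p a b" "has_partials S z h p c d" "p \<in> S"
  shows "has_partials S z (\<lambda>p. inner (g p) (h p)) p
           (inner (g p) c + inner a (h p)) (inner (g p) d + inner b (h p))"
  using has_derivative_inner[OF assms(1,2)[unfolded has_partials_def]] assms(3)
  by (simp add: has_partials_def coord_inverse_self inner_add_left inner_add_right algebra_simps)

lemma has_partials_scaleR_fun:
  fixes g :: "'a \<Rightarrow> real"
  assumes "has_partials S z g p a b" "has_partials S z h p c d" "p \<in> S"
  shows "has_partials S z (\<lambda>p. g p *\<^sub>R h p) p (g p *\<^sub>R c + a *\<^sub>R h p) (g p *\<^sub>R d + b *\<^sub>R h p)"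
  using has_derivative_scaleR[OF assms(1,2)[unfolded has_partials_def]] assms(3)
  by (simp add: has_partials_def coord_inverse_self algebra_simps)

lemma inner_const_partials:
  assumes "has_partials S z g p a b" "has_partials S z h p c d" "p \<in> S"
    and "\<And>q. q \<in> S \<Longrightarrow> inner (g q) (h q) = C"
  shows "inner (g p) c + inner a (h p) = 0" "inner (g p) d + inner b (h p) = 0"
  using has_partials_unique[OF has_partials_transform[OF has_partials_inner[OF assms(1-3)] assms(3,4)]
      has_partials_const] by auto

text \<open>In one fixed chart the derivative vanishes on a ball, which makes \<open>g\<close>
  locally constant; connectedness does the rest.\<close>

lemma zero_partials_constant:
  assumes "connected S" and zero: "\<And>p. p \<in> S \<Longrightarrow> has_partials S z g p 0 0"
  shows "\<exists>c. \<forall>p\<in>S. g p = c"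
proof -
  have "\<exists>T. openin (top_of_set S) T \<and> p \<in> T \<and> (\<forall>q\<in>T. g q = g p)" if "p \<in> S" for p
  proof -
    obtain V h where V: "p \<in> V" "coord_inverse_on S z V h"
      using coord \<open>p \<in> S\<close> unfolding complex_coordinate_def by blast
    have VS: "V \<subseteq> S" and hom: "homeomorphism V (z ` V) z h"
      using V by (auto simp: coord_inverse_on_def dest: openin_imp_subset)
    obtain e where e: "e > 0" "ball (z p) e \<subseteq> z ` V"
      using V by (metis coord_inverse_on_def image_eqI open_contains_ball)
    \<comment> \<open>The hypothesis at the point \<open>h w\<close> speaks of the local inverse
      chosen there; it is exchanged for the fixed \<open>h\<close>, with which it agrees near
      \<open>w\<close>.\<close>
    have "((\<lambda>w. g (h w)) has_derivative (\<lambda>_. 0)) (at w within ball (z p) e)" if w: "w \<in> ball (z p) e" for w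
    proof -
      have q: "h w \<in> V" "z (h w) = w"
        using w e hom by (auto simp: homeomorphism_def)
      then have qS: "h w \<in> S" using VS by blast
      obtain V' where V': "h w \<in> V'" "coord_inverse_on S z V' (coord_inverse S z (h w))"
        using qS by (rule coord_inverse_on_coord_inverse)
      have ev: "\<forall>\<^sub>F y in nhds w. coord_inverse S z (h w) y = h y"
        using coord_inverse_on_eventually_eq[OF V' q(1) V(2)] q by simp
      have "((\<lambda>y. g (coord_inverse S z (h w) y)) has_derivative (\<lambda>_. 0)) (at w)"
        using zero[OF qS] q by (simp add: has_partials_def)
      then have "((\<lambda>y. g (h y)) has_derivative (\<lambda>_. 0)) (at w)"
      proof (rule has_derivative_transform_eventually)
        show "\<forall>\<^sub>F y in at w. g (coord_inverse S z (h w) y) = g (h y)"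
          using ev by (auto simp: eventually_at_filter elim!: eventually_mono)
        show "g (coord_inverse S z (h w) w) = g (h w)"
          using eventually_nhds_x_imp_x[OF ev] by simp
      qed simp
      then show ?thesis by (rule has_derivative_at_withinI)
    qed
    then obtain c where c: "\<And>w. w \<in> ball (z p) e \<Longrightarrow> g (h w) = c"
      using has_derivative_zero_constant[OF convex_ball, of "z p" e "\<lambda>w. g (h w)"] by blast
    let ?T = "V \<inter> z -` ball (z p) e"
    have hz: "h (z q) = q" if "q \<in> V" for q using hom that by (auto simp: homeomorphism_def)
    have "openin (top_of_set V) ?T"
      using hom by (intro continuous_openin_preimage_gen) (auto simp: homeomorphism_def)
    then have "openin (top_of_set S) ?T"
      using V by (meson coord_inverse_on_def openin_trans)
    moreover have "g q = g p" if "q \<in> ?T" for q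
      using c[of "z q"] c[of "z p"] that e V hz by auto
    moreover have "p \<in> ?T"
      using V(1) e(1) by simp
    ultimately show ?thesis
      by blast
  qed
  then have "g constant_on S"
    using assms(1) locally_constant_imp_constant by blast
  then show ?thesis by (auto simp: constant_on_def)
qed

end

lemma complex_coordinate_plane: "complex_coordinate UNIV (\<lambda>w. w)"
  unfolding complex_coordinate_def coord_inverse_on_def
  by (intro ballI exI[of _ UNIV] exI[of _ "\<lambda>w. w"]) (auto simp: homeomorphism_def)


section \<open>Structure equations with constant coefficients\<close>

definition orthogonal_frame :: "real^4 \<Rightarrow> real^4 \<Rightarrow> real^4 \<Rightarrow> real^4 \<Rightarrow> bool" where
  "orthogonal_frame f u v n \<longleftrightarrow> f \<noteq> 0 \<and> u \<noteq> 0 \<and> v \<noteq> 0 \<and> n \<noteq> 0 \<and>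
     inner f u = 0 \<and> inner f v = 0 \<and> inner f n = 0 \<and>
     inner u v = 0 \<and> inner u n = 0 \<and> inner v n = 0"

text \<open>Four nonzero pairwise orthogonal vectors are independent, so they span the space and
  \<open>w\<close> is orthogonal to itself.\<close>

lemma orthogonal_frame_zero:
  assumes fr: "orthogonal_frame f u v n"
    and "inner w f = 0" "inner w u = 0" "inner w v = 0" "inner w n = 0"
  shows "w = 0"
proof -
  let ?B = "{f, u, v, n}"
  have po: "pairwise orthogonal ?B" and nz: "0 \<notin> ?B"
    using fr by (auto simp: orthogonal_frame_def pairwise_def orthogonal_def inner_commute)
  have "f \<noteq> u" "f \<noteq> v" "f \<noteq> n" "u \<noteq> v" "u \<noteq> n" "v \<noteq> n"
    using fr by (auto simp: orthogonal_frame_def)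
  then have "card ?B = 4" by simp
  moreover have "independent ?B"
    using po nz by (rule pairwise_orthogonal_independent)
  ultimately have "span ?B = UNIV"
    by (intro equalityI subset_UNIV card_ge_dim_independent) auto
  then have "orthogonal w w"
    using assms(2-) by (intro orthogonal_to_span[of w ?B w]) (auto simp: orthogonal_def)
  then show ?thesis by (simp add: orthogonal_self)
qed

lemma orthogonal_frame_expand:
  assumes fr: "orthogonal_frame f u v n"
  shows "w = (inner w f / inner f f) *\<^sub>R f + (inner w u / inner u u) *\<^sub>R u
           + (inner w v / inner v v) *\<^sub>R v + (inner w n / inner n n) *\<^sub>R n" (is "w = ?r")
proof -
  have "w - ?r = 0"
    by (rule orthogonal_frame_zero[OF fr])
       (use fr in \<open>auto simp: orthogonal_frame_def inner_diff_left inner_add_left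
         inner_diff_right inner_add_right inner_commute\<close>)
  then show ?thesis by simp
qed

text \<open>
  Here \<open>u\<close> and \<open>v\<close> play the roles of $f_x$ and $f_y$, with squared lengths \<open>k\<close> and \<open>l\<close>, and
  $a = \langle f_{xx}, n\rangle = - \langle f_{yy}, n\rangle$, $b = \langle f_{xy}, n\rangle$, so that
  $2\mu = a - ib$. The equations for \<open>n\<close> itself follow from its differentiability.
\<close>

definition structure_equations ::
  "'a::t2_space set \<Rightarrow> ('a \<Rightarrow> complex) \<Rightarrow> real \<Rightarrow> real \<Rightarrow> real \<Rightarrow> real \<Rightarrow>
   ('a \<Rightarrow> real^4) \<Rightarrow> ('a \<Rightarrow> real^4) \<Rightarrow> ('a \<Rightarrow> real^4) \<Rightarrow> ('a \<Rightarrow> real^4) \<Rightarrow> bool" where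
  "structure_equations S z k l a b f u v n \<longleftrightarrow> k > 0 \<and> l > 0 \<and>
     (\<forall>p\<in>S. orthogonal_frame (f p) (u p) (v p) (n p) \<and>
       inner (f p) (f p) = 1 \<and> inner (u p) (u p) = k \<and> inner (v p) (v p) = l \<and> inner (n p) (n p) = 1 \<and>
       has_partials S z f p (u p) (v p) \<and>
       has_partials S z u p (- k *\<^sub>R f p + a *\<^sub>R n p) (b *\<^sub>R n p) \<and>
       has_partials S z v p (b *\<^sub>R n p) (- l *\<^sub>R f p - a *\<^sub>R n p) \<and>
       (\<exists>c d. has_partials S z n p c d))"

text \<open>The Weingarten equations. Differentiating the orthogonality of \<open>n\<close> to
  \<open>f\<close>, \<open>u\<close>, \<open>v\<close> and its unit length yields all frame
  components of its derivatives.\<close>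

lemma structure_equations_normal:
  assumes coord: "complex_coordinate S z" and st: "structure_equations S z k l a b f u v n" and p: "p \<in> S"
  shows "has_partials S z n p (- (a / k) *\<^sub>R u p - (b / l) *\<^sub>R v p) (- (b / k) *\<^sub>R u p + (a / l) *\<^sub>R v p)"
proof -
  have st': "orthogonal_frame (f q) (u q) (v q) (n q)" "inner (f q) (f q) = 1" "inner (u q) (u q) = k"
    "inner (v q) (v q) = l" "inner (n q) (n q) = 1" if "q \<in> S" for q
    using st that by (auto simp: structure_equations_def)
  have hf: "has_partials S z f p (u p) (v p)"
    and hu: "has_partials S z u p (- k *\<^sub>R f p + a *\<^sub>R n p) (b *\<^sub>R n p)"
    and hv: "has_partials S z v p (b *\<^sub>R n p) (- l *\<^sub>R f p - a *\<^sub>R n p)"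
    using st p by (auto simp: structure_equations_def)
  obtain c d where n: "has_partials S z n p c d"
    using st p by (auto simp: structure_equations_def)
  have o: "inner (n q) (f q) = 0" "inner (n q) (u q) = 0" "inner (n q) (v q) = 0" if "q \<in> S" for q
    using st'(1)[OF that] by (auto simp: orthogonal_frame_def inner_commute)
  note ip = inner_const_partials[OF coord]
  have e1: "inner c (f p) = 0" "inner d (f p) = 0"
    using ip[OF n hf p o(1)] o p by auto
  have e2: "inner c (u p) = - a" "inner d (u p) = - b"
    using ip[OF n hu p o(2)] o[OF p] st'[OF p] by (auto simp: inner_add_right inner_diff_right)
  have e3: "inner c (v p) = - b" "inner d (v p) = a"
    using ip[OF n hv p o(3)] o[OF p] st'[OF p] by (auto simp: inner_add_right inner_diff_right)
  have e4: "inner c (n p) = 0" "inner d (n p) = 0"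
    using ip[OF n n p st'(5)] by (auto simp: inner_commute)
  have "c = - (a / k) *\<^sub>R u p - (b / l) *\<^sub>R v p" "d = - (b / k) *\<^sub>R u p + (a / l) *\<^sub>R v p"
    using orthogonal_frame_expand[OF st'(1)[OF p], of c] orthogonal_frame_expand[OF st'(1)[OF p], of d]
    by (simp_all add: e1 e2 e3 e4 st'[OF p])
  with n show ?thesis by simp
qed

text \<open>Uniqueness for a linear system: the map carrying the primed frame to the other one is
  constant, because both frames satisfy the same equations and the connection coefficients are skew.
  At a base point it is an isometry by Parseval's identity.\<close>

lemma congruent_maps_structure:
  assumes coord: "complex_coordinate S z" and conn: "connected S"
    and st: "structure_equations S z k l a b f u v n"
    and st': "structure_equations S z k l a b f' u' v' n'"
  shows "congruent_maps S f' f"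
proof (cases "S = {}")
  case True
  then show ?thesis
    unfolding congruent_maps_def by (auto intro: orthogonal_transformation_id)
next
  case False
  then obtain p0 where p0: "p0 \<in> S" by blast
  have kl: "k > 0" "l > 0" using st by (auto simp: structure_equations_def)
  \<comment> \<open>The frame vectors have squared lengths 1, \<open>k\<close>, \<open>l\<close>, 1,
    so with these factors \<open>C p\<close> sends each primed vector at \<open>p\<close> to the
    unprimed one.\<close>
  define C where "C p x = inner x (f' p) *\<^sub>R f p + (1/k) *\<^sub>R (inner x (u' p) *\<^sub>R u p)
     + (1/l) *\<^sub>R (inner x (v' p) *\<^sub>R v p) + inner x (n' p) *\<^sub>R n p" for p x
  have "\<exists>c. \<forall>p\<in>S. C p x = c" for x
  proof (rule zero_partials_constant[OF coord conn])
    fix p assume p: "p \<in> S"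
    have h: "has_partials S z f p (u p) (v p)"
       "has_partials S z u p (- k *\<^sub>R f p + a *\<^sub>R n p) (b *\<^sub>R n p)"
       "has_partials S z v p (b *\<^sub>R n p) (- l *\<^sub>R f p - a *\<^sub>R n p)"
      using st p by (auto simp: structure_equations_def)
    have h': "has_partials S z f' p (u' p) (v' p)"
       "has_partials S z u' p (- k *\<^sub>R f' p + a *\<^sub>R n' p) (b *\<^sub>R n' p)"
       "has_partials S z v' p (b *\<^sub>R n' p) (- l *\<^sub>R f' p - a *\<^sub>R n' p)"
      using st' p by (auto simp: structure_equations_def)
    note hn = structure_equations_normal[OF coord st p] and hn' = structure_equations_normal[OF coord st' p]
    have *: "has_partials S z (\<lambda>p. inner x (g' p) *\<^sub>R g p) p
        (inner x (g' p) *\<^sub>R c + inner x c' *\<^sub>R g p) (inner x (g' p) *\<^sub>R d + inner x d' *\<^sub>R g p)"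
      if "has_partials S z g p c d" "has_partials S z g' p c' d'" for g :: "'a \<Rightarrow> real^4" and g' :: "'a \<Rightarrow> real^4" and c d c' d'
      by (rule has_partials_scaleR_fun[OF coord has_partials_linear[OF bounded_linear_inner_right that(2)] that(1) p])
    have "has_partials S z (\<lambda>p. C p x) p 
       (inner x (f' p) *\<^sub>R u p + inner x (u' p) *\<^sub>R f p
         + (1/k) *\<^sub>R (inner x (u' p) *\<^sub>R (- k *\<^sub>R f p + a *\<^sub>R n p) + inner x (- k *\<^sub>R f' p + a *\<^sub>R n' p) *\<^sub>R u p)
         + (1/l) *\<^sub>R (inner x (v' p) *\<^sub>R (b *\<^sub>R n p) + inner x (b *\<^sub>R n' p) *\<^sub>R v p)
         + (inner x (n' p) *\<^sub>R (- (a / k) *\<^sub>R u p - (b / l) *\<^sub>R v p) + inner x (- (a / k) *\<^sub>R u' p - (b / l) *\<^sub>R v' p) *\<^sub>R n p))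
       (inner x (f' p) *\<^sub>R v p + inner x (v' p) *\<^sub>R f p
         + (1/k) *\<^sub>R (inner x (u' p) *\<^sub>R (b *\<^sub>R n p) + inner x (b *\<^sub>R n' p) *\<^sub>R u p)
         + (1/l) *\<^sub>R (inner x (v' p) *\<^sub>R (- l *\<^sub>R f p - a *\<^sub>R n p) + inner x (- l *\<^sub>R f' p - a *\<^sub>R n' p) *\<^sub>R v p)
         + (inner x (n' p) *\<^sub>R (- (b / k) *\<^sub>R u p + (a / l) *\<^sub>R v p) + inner x (- (b / k) *\<^sub>R u' p + (a / l) *\<^sub>R v' p) *\<^sub>R n p))"
      (is "has_partials _ _ _ _ ?dx ?dy")
      unfolding C_def
      by (intro has_partials_add has_partials_scaleR * h h' hn hn')
    moreover have "?dx = 0" "?dy = 0"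
      using kl by (simp_all add: vec_eq_iff inner_add_right inner_diff_right field_simps)
    ultimately show "has_partials S z (\<lambda>p. C p x) p 0 0" by simp
  qed
  then have C0: "C p x = C p0 x" if "p \<in> S" for p x
    using p0 that by metis
  have o: "orthogonal_frame (f p) (u p) (v p) (n p)" "inner (f p) (f p) = 1" "inner (u p) (u p) = k"
    "inner (v p) (v p) = l" "inner (n p) (n p) = 1" if "p \<in> S" for p
    using st that by (auto simp: structure_equations_def)
  have o': "orthogonal_frame (f' p) (u' p) (v' p) (n' p)" "inner (f' p) (f' p) = 1" "inner (u' p) (u' p) = k"
    "inner (v' p) (v' p) = l" "inner (n' p) (n' p) = 1" if "p \<in> S" for p
    using st' that by (auto simp: structure_equations_def)
  have "f p = C p0 (f' p)" if p: "p \<in> S" for p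
    using o'[OF p] unfolding C0[OF p, symmetric] by (simp add: C_def orthogonal_frame_def)
  moreover have "orthogonal_transformation (C p0)"
    unfolding orthogonal_transformation_def
  proof (intro conjI allI)
    show "linear (C p0)"
      unfolding C_def by (intro linearI) (simp_all add: inner_add_left algebra_simps)
    fix x y
    have "inner (C p0 x) (C p0 y) = inner x (f' p0) * inner y (f' p0) + inner x (u' p0) * inner y (u' p0) / k
       + inner x (v' p0) * inner y (v' p0) / l + inner x (n' p0) * inner y (n' p0)"
      using o[OF p0] kl
      by (simp add: C_def orthogonal_frame_def inner_add_left inner_add_right inner_commute mult.commute)
    also have "\<dots> = inner x y"
    proof -
      have "inner x y = inner x ((inner y (f' p0) / 1) *\<^sub>R f' p0 + (inner y (u' p0) / k) *\<^sub>R u' p0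
           + (inner y (v' p0) / l) *\<^sub>R v' p0 + (inner y (n' p0) / 1) *\<^sub>R n' p0)"
        using orthogonal_frame_expand[OF o'(1)[OF p0], of y] o'(2-)[OF p0] by simp
      then show ?thesis by (simp add: inner_add_right mult.commute)
    qed
    finally show "inner (C p0 x) (C p0 y) = inner x y" .
  qed
  ultimately show ?thesis
    unfolding congruent_maps_def by blast
qed

text \<open>Removing their components along \<open>v\<close> leaves \<open>g\<close> and
  \<open>h\<close> on the line orthogonal to \<open>f\<close>, \<open>u\<close>, \<open>v\<close>.
  Both remainders have squared length 1 - 4 / |v|^2, which is positive since \<open>u\<close> is
  nonzero, so they are equal or opposite. The use is with \<open>g\<close> and \<open>h\<close> the
  images of \<open>f\<close> under R and its inverse.\<close>

lemma unit_vectors_alternative: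
  fixes f u v g h :: "real^4"
  assumes "inner f f = 1" "inner f u = 0" "inner f v = 0" "inner u v = 0" "u \<noteq> 0"
    and vv: "inner v v = inner u u + 4" and e: "\<epsilon>\<^sup>2 = 1"
    and g: "inner g g = 1" "inner g f = 0" "inner g u = 0" "inner g v = 2 * \<epsilon>"
    and h: "inner h h = 1" "inner h f = 0" "inner h u = 0" "inner h v = - 2 * \<epsilon>"
  shows "orthogonal_frame f u v (g - (2 * \<epsilon> / inner v v) *\<^sub>R v)"
    and "g - h = (4 * \<epsilon> / inner v v) *\<^sub>R v \<or> h = - g"
proof -
  define l where "l = inner v v"
  have l: "l > 4" using assms by (simp add: l_def vv)
  define n where "n = g - (2 * \<epsilon> / l) *\<^sub>R v"
  define m where "m = h + (2 * \<epsilon> / l) *\<^sub>R v"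
  have nn: "inner n n = 1 - 4 / l" and mm: "inner m m = 1 - 4 / l"
    using g h l e unfolding n_def m_def
    by (simp_all add: inner_diff_left inner_diff_right inner_add_left inner_add_right inner_commute
        l_def[symmetric] power2_eq_square field_simps)
  have "inner n n \<noteq> 0" using l by (simp add: nn)
  then have "n \<noteq> 0" by auto
  moreover have "v \<noteq> 0" "f \<noteq> 0" using l assms(1) by (auto simp: l_def)
  ultimately have fr: "orthogonal_frame f u v n"
    using assms(1-5) g l
    by (auto simp: orthogonal_frame_def n_def inner_diff_right inner_commute l_def[symmetric])
  then show "orthogonal_frame f u v (g - (2 * \<epsilon> / inner v v) *\<^sub>R v)"
    by (simp add: n_def l_def)
  have "inner m f = 0" "inner m u = 0" "inner m v = 0"
    using assms(1-5) h l
    by (auto simp: m_def inner_add_left inner_add_right inner_commute l_def[symmetric])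
  then obtain c where c: "m = c *\<^sub>R n"
    using orthogonal_frame_expand[OF fr, of m] by auto
  then have "c * c * inner n n = inner n n" using nn mm by simp
  then have "c = 1 \<or> c = - 1" using \<open>inner n n \<noteq> 0\<close> by (simp add: square_eq_1_iff)
  then show "g - h = (4 * \<epsilon> / inner v v) *\<^sub>R v \<or> h = - g"
  proof
    assume "c = 1"
    then have "h = n - (2 * \<epsilon> / l) *\<^sub>R v" using c by (simp add: m_def eq_diff_eq)
    then show ?thesis by (simp add: n_def l_def vec_eq_iff)
  next
    assume "c = -1"
    then have "h + g = 0" using c by (simp add: m_def n_def eq_diff_eq)
    then show ?thesis by (simp add: eq_neg_iff_add_eq_0)
  qed
qed


section \<open>Maps congruent to their transform\<close>

text \<open>The transform enters only through the inner products in the last three hypotheses, so no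
  quaternions occur here. \<open>w\<close> is the common value of the two mixed derivatives.\<close>

lemma self_transform_structure:
  fixes f u v ux w vy :: "'a::t2_space \<Rightarrow> real^4"
  assumes coord: "complex_coordinate S z" and conn: "connected S" and ne: "S \<noteq> {}"
    and hf: "\<And>p. p \<in> S \<Longrightarrow> has_partials S z f p (u p) (v p)"
    and hu: "\<And>p. p \<in> S \<Longrightarrow> has_partials S z u p (ux p) (w p)"
    and hv: "\<And>p. p \<in> S \<Longrightarrow> has_partials S z v p (w p) (vy p)"
    and ff: "\<And>p. p \<in> S \<Longrightarrow> inner (f p) (f p) = 1"
    and uv: "\<And>p. p \<in> S \<Longrightarrow> inner (u p) (v p) = 0"
    and vv: "\<And>p. p \<in> S \<Longrightarrow> inner (v p) (v p) = inner (u p) (u p) + 4"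
    and u0: "\<And>p. p \<in> S \<Longrightarrow> u p \<noteq> 0"
    and harm: "\<And>p. p \<in> S \<Longrightarrow> ux p + vy p = - (inner (u p) (u p) + inner (v p) (v p)) *\<^sub>R f p"
    and R: "orthogonal_transformation R" and e: "\<epsilon>\<^sup>2 = 1"
    and Rff: "\<And>p. p \<in> S \<Longrightarrow> inner (R (f p)) (f p) = 0"
    and Rfu: "\<And>p. p \<in> S \<Longrightarrow> inner (R (f p)) (u p) = 0"
    and Rfv: "\<And>p. p \<in> S \<Longrightarrow> inner (R (f p)) (v p) = 2 * \<epsilon>"
  shows "\<exists>k a b n. a\<^sup>2 + b\<^sup>2 = k * (k + 4) \<and> structure_equations S z k (k + 4) a b f u v n"
proof -
  note ip = inner_const_partials[OF coord]
  note un = has_partials_unique and tr = has_partials_transform[OF coord]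
  define Q where "Q = inv R"
  have linR: "linear R" and RR: "inner (R x) (R y) = inner x y" for x y
    using R by (auto simp: orthogonal_transformation_def)
  have RQ: "R (Q x) = x" and QR: "Q (R x) = x" for x
    using orthogonal_transformation_bij[OF R] by (simp_all add: Q_def bij_def surj_f_inv_f inv_f_f)
  have adj: "inner (Q x) y = inner x (R y)" for x y
    using RR[of "Q x" y] by (simp add: RQ)
  have linQ: "linear Q"
    using orthogonal_transformation_inv[OF R] by (simp add: Q_def orthogonal_transformation_linear)
  have blR: "bounded_linear R"
    using linR by (simp add: linear_conv_bounded_linear)
  have fu: "inner (f p) (u p) = 0" and fv: "inner (f p) (v p) = 0" if p: "p \<in> S" for p
    using ip[OF hf[OF p] hf[OF p] p ff] by (auto simp: inner_commute)
  note hRf = has_partials_linear[OF blR hf] and hRu = has_partials_linear[OF blR hu]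
    and hRv = has_partials_linear[OF blR hv]
  have Ruf: "inner (R (u p)) (f p) = 0" and Rvf: "inner (R (v p)) (f p) = - 2 * \<epsilon>" if p: "p \<in> S" for p
    using ip[OF hRf[OF p] hf[OF p] p Rff] Rfu Rfv p by auto
  \<comment> \<open>These are the derivatives of \<open>Rfu\<close>, \<open>Rfv\<close>,
    \<open>Ruf\<close> and \<open>Rvf\<close>. Eliminating the inner products of first derivatives
    compares \<open>R (f p)\<close> with \<open>Q (f p)\<close> on second derivatives.\<close>
  have d2: "inner (R (u p)) (u p) + inner (R (f p)) (ux p) = 0"
    "inner (R (v p)) (u p) + inner (R (f p)) (w p) = 0"
    "inner (R (u p)) (v p) + inner (R (f p)) (w p) = 0"
    "inner (R (v p)) (v p) + inner (R (f p)) (vy p) = 0"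
    "inner (R (ux p)) (f p) + inner (R (u p)) (u p) = 0"
    "inner (R (w p)) (f p) + inner (R (u p)) (v p) = 0"
    "inner (R (vy p)) (f p) + inner (R (v p)) (v p) = 0" if p: "p \<in> S" for p
    using ip[OF hRf[OF p] hu[OF p] p Rfu] ip[OF hRf[OF p] hv[OF p] p Rfv]
      ip[OF hRu[OF p] hf[OF p] p Ruf] ip[OF hRv[OF p] hf[OF p] p Rvf] by auto
  have V0: "inner (R (f p) - Q (f p)) (ux p) = 0" "inner (R (f p) - Q (f p)) (w p) = 0"
    "inner (R (f p) - Q (f p)) (vy p) = 0" if p: "p \<in> S" for p
    using d2[OF p] by (auto simp: inner_diff_left adj inner_commute[of "f p"])
  have Q1: "inner (Q (f p)) (f p) = 0" "inner (Q (f p)) (u p) = 0" "inner (Q (f p)) (v p) = - 2 * \<epsilon>"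
    if p: "p \<in> S" for p
    using Rff[OF p] Ruf[OF p] Rvf[OF p] by (auto simp: adj inner_commute[of "f p"])
  have QQ: "inner (Q x) (Q y) = inner x y" for x y by (simp add: adj RQ)
  have R0: "inner (R (f p)) (R (f p)) = 1" "inner (Q (f p)) (Q (f p)) = 1" if "p \<in> S" for p
    using ff[OF that] by (simp_all add: RR QQ)
  have frame: "orthogonal_frame (f p) (u p) (v p) (R (f p) - (2 * \<epsilon> / inner (v p) (v p)) *\<^sub>R v p)"
    if p: "p \<in> S" for p
    using unit_vectors_alternative(1)[where \<epsilon> = \<epsilon>, OF ff[OF p] fu[OF p] fv[OF p] uv[OF p] u0[OF p] vv[OF p] e
       R0(1)[OF p] Rff[OF p] Rfu[OF p] Rfv[OF p] R0(2)[OF p] Q1[OF p]] .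
  txt \<open>
    The alternative \<open>Q (f p) = - R (f p)\<close> is excluded because it would make \<open>R (u p)\<close> orthogonal to a
    whole frame.
  \<close>
  have V: "R (f p) - Q (f p) = (4 * \<epsilon> / inner (v p) (v p)) *\<^sub>R v p" if p: "p \<in> S" for p
  proof (rule ccontr)
    assume "R (f p) - Q (f p) \<noteq> (4 * \<epsilon> / inner (v p) (v p)) *\<^sub>R v p"
    then have m: "Q (f p) = - R (f p)"
      using unit_vectors_alternative(2)[where \<epsilon> = \<epsilon>, OF ff[OF p] fu[OF p] fv[OF p] uv[OF p] u0[OF p] vv[OF p] e
       R0(1)[OF p] Rff[OF p] Rfu[OF p] Rfv[OF p] R0(2)[OF p] Q1[OF p]] by blast
    have z: "inner (R (f p)) (ux p) = 0" "inner (R (f p)) (w p) = 0"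
      using V0[OF p] unfolding m by (simp_all del: mult_2 add: scaleR_2[symmetric])
    have "inner (R (u p)) (R (f p)) = 0" using fu[OF p] by (simp add: RR inner_commute)
    then have "R (u p) = 0"
      using d2[OF p] z Ruf[OF p]
      by (intro orthogonal_frame_zero[OF frame[OF p]]) (auto simp: inner_diff_right)
    then have "inner (u p) (u p) = 0" using RR[of "u p" "u p"] by simp
    then show False using u0[OF p] by simp
  qed
  have vpos: "inner (v p) (v p) > 4" if "p \<in> S" for p
    using u0[OF that] by (simp add: vv[OF that])
  have e0: "\<epsilon> \<noteq> 0" using e by auto
  have vd: "inner (v p) (w p) = 0" "inner (v p) (vy p) = 0" if p: "p \<in> S" for p
    using V0[OF p] V[OF p] vpos[OF p] e0 by auto
  have "\<exists>c. \<forall>p\<in>S. inner (v p) (v p) = c"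
  proof (rule zero_partials_constant[OF coord conn])
    fix p assume p: "p \<in> S"
    show "has_partials S z (\<lambda>p. inner (v p) (v p)) p 0 0"
      using has_partials_inner[OF coord hv[OF p] hv[OF p] p] vd[OF p] by (simp add: inner_commute)
  qed
  then obtain l where l: "\<And>p. p \<in> S \<Longrightarrow> inner (v p) (v p) = l" by blast
  define k where "k = l - 4"
  have uu: "inner (u p) (u p) = k" if "p \<in> S" for p
    using l[OF that] vv[OF that] by (simp add: k_def)
  obtain p0 where p0: "p0 \<in> S" using ne by blast
  have kl: "k > 0" "l > 0" using vpos[OF p0] l[OF p0] by (auto simp: k_def)
  \<comment> \<open>Since \<open>k = l - 4\<close>, this is the root of 1 - 4 / l, the length of the
    part of \<open>R (f p)\<close> orthogonal to \<open>v p\<close>; it normalises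
    \<open>n\<close>.\<close>
  define \<tau> where "\<tau> = sqrt (k / l)"
  have \<tau>: "\<tau> > 0" "\<tau> * \<tau> = k / l" using kl by (auto simp: \<tau>_def)
  txt \<open>\<open>Z\<close> is skew, \<open>D\<close> is symmetric, they commute, and on the image of \<open>f\<close> they give \<open>v\<close> and the unit normal.\<close>
  define Z where "Z x = (\<epsilon> * l / 4) *\<^sub>R (R x - Q x)" for x
  define D where "D x = (1 / (2 * \<tau>)) *\<^sub>R (R x + Q x)" for x
  have linZ: "linear Z" unfolding Z_def
    by (intro linear_compose_scale_right linear_compose_sub linR linQ)
  have linD: "linear D" unfolding D_def
    by (intro linear_compose_scale_right linear_compose_add linR linQ)
  have blZ: "bounded_linear Z" and blD: "bounded_linear D"
    using linZ linD by (simp_all add: linear_conv_bounded_linear)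
  have skew: "inner (Z x) y = - inner x (Z y)" for x y
    by (simp add: Z_def inner_diff_left inner_diff_right adj inner_commute[of "R x" y] algebra_simps)
       (metis adj inner_commute)
  have symm: "inner (D x) y = inner x (D y)" for x y
    by (simp add: D_def inner_add_left inner_add_right adj algebra_simps)
       (metis adj inner_commute)
  have comm: "D (Z x) = Z (D x)" for x
    by (simp add: D_def Z_def linear_cmul[OF linR] linear_cmul[OF linQ] linear_diff[OF linR] linear_diff[OF linQ]
       linear_add[OF linR] linear_add[OF linQ] RQ QR algebra_simps)
  \<comment> \<open>The product of a symmetric and a skew map that commute is again skew.\<close>
  have skew0: "inner (Z x) (D x) = 0" for x
  proof -
    have "inner (Z x) (D x) = inner (D (Z x)) x" by (simp add: symm)
    also have "\<dots> = - inner (D x) (Z x)" by (simp add: comm skew)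
    finally show ?thesis by (simp add: inner_commute)
  qed
  define n where "n p = D (f p)" for p
  have vZ: "v p = Z (f p)" if p: "p \<in> S" for p
    using V[OF p] l[OF p] kl e by (simp add: Z_def power2_eq_square)
  have Rn: "R (f p) - (2 * \<epsilon> / l) *\<^sub>R v p = \<tau> *\<^sub>R n p" if p: "p \<in> S" for p
  proof -
    have "Q (f p) = R (f p) - (4 * \<epsilon> / l) *\<^sub>R v p" using V[OF p] l[OF p] by (simp add: algebra_simps)
    then show ?thesis using \<tau> by (simp add: n_def D_def vec_eq_iff field_simps)
  qed
  have fr: "orthogonal_frame (f p) (u p) (v p) (n p)" if p: "p \<in> S" for p
    using frame[OF p] \<tau> unfolding l[OF p] Rn[OF p] by (auto simp: orthogonal_frame_def)
  have nn: "inner (n p) (n p) = 1" if p: "p \<in> S" for p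
  proof -
    have "\<tau> * \<tau> * inner (n p) (n p) = inner (R (f p) - (2 * \<epsilon> / l) *\<^sub>R v p) (R (f p) - (2 * \<epsilon> / l) *\<^sub>R v p)"
      unfolding Rn[OF p] by simp
    also have "\<dots> = 1 - 4 / l"
      using R0[OF p] Rfv[OF p] l[OF p] kl e
      by (simp add: inner_diff_left inner_diff_right inner_commute power2_eq_square field_simps)
    also have "\<dots> = \<tau> * \<tau>" using kl \<tau> by (simp add: k_def field_simps)
    finally show ?thesis using \<tau>(1) by simp
  qed
  \<comment> \<open>As \<open>Z\<close> is constant, differentiating \<open>v = Z f\<close>
    expresses \<open>w\<close> and \<open>vy\<close> by first derivatives, so their normal
    components can be differentiated in turn.\<close>
  have wZ: "w p = Z (u p)" and vyZ: "vy p = Z (v p)" if p: "p \<in> S" for p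
    using un[OF hv[OF p] tr[OF has_partials_linear[OF blZ hf[OF p]] p vZ[symmetric]]] by auto
  have hn: "has_partials S z n p (D (u p)) (D (v p))" if p: "p \<in> S" for p
    unfolding n_def by (rule has_partials_linear[OF blD hf[OF p]])
  have ny: "D (v p) = Z (n p)" if p: "p \<in> S" for p
    by (simp add: n_def vZ[OF p] comm)
  have fo: "inner (n p) (f p) = 0" "inner (n p) (u p) = 0" "inner (n p) (v p) = 0" "inner (f p) (n p) = 0"
      "inner (u p) (n p) = 0" "inner (v p) (n p) = 0" if "p \<in> S" for p
    using fr[OF that] by (auto simp: orthogonal_frame_def inner_commute)
  have c1: "inner (ux p) (f p) = - k" "inner (w p) (f p) = 0" if p: "p \<in> S" for p
    using ip[OF hf[OF p] hu[OF p] p fu] uu[OF p] uv[OF p] by (auto simp: inner_commute)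
  have c2: "inner (ux p) (u p) = 0" "inner (w p) (u p) = 0" if p: "p \<in> S" for p
    using ip[OF hu[OF p] hu[OF p] p uu] by (auto simp: inner_commute)
  have c3: "inner (w p) (v p) = 0" if p: "p \<in> S" for p
    using vd[OF p] by (simp add: inner_commute)
  have c4: "inner (ux p) (v p) = 0" if p: "p \<in> S" for p
    using ip[OF hu[OF p] hv[OF p] p uv] c2[OF p] by (simp add: inner_commute)
  define A where "A p = inner (ux p) (n p)" for p
  define B where "B p = inner (w p) (n p)" for p
  \<comment> \<open>The vectors \<open>f\<close>, \<open>u\<close>, \<open>v\<close> are orthogonal
    and of constant length, which removes all tangential components; only those along
    \<open>f\<close> and \<open>n\<close> survive.\<close>
  have uxe: "ux p = - k *\<^sub>R f p + A p *\<^sub>R n p" if p: "p \<in> S" for p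
    using orthogonal_frame_expand[OF fr[OF p], of "ux p"]
    by (simp add: c1[OF p] c2[OF p] c4[OF p] ff[OF p] nn[OF p] A_def)
  have we: "w p = B p *\<^sub>R n p" if p: "p \<in> S" for p
    using orthogonal_frame_expand[OF fr[OF p], of "w p"]
    by (simp add: c1[OF p] c2[OF p] c3[OF p] ff[OF p] nn[OF p] B_def)
  have vye: "vy p = - l *\<^sub>R f p - A p *\<^sub>R n p" if p: "p \<in> S" for p
  proof -
    have "vy p = - (k + l) *\<^sub>R f p - ux p"
      using harm[OF p] unfolding uu[OF p] l[OF p] by (metis add_diff_cancel_left')
    then show ?thesis by (simp add: uxe[OF p] algebra_simps)
  qed
  have Zn: "inner (f p) (Z (n p)) = 0" "inner (n p) (Z (n p)) = 0" if p: "p \<in> S" for p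
  proof -
    show "inner (f p) (Z (n p)) = 0" using skew[of "f p" "n p"] fo[OF p] by (simp add: vZ[OF p, symmetric])
    show "inner (n p) (Z (n p)) = 0" using skew[of "n p" "n p"] by (simp add: inner_commute)
  qed
  \<comment> \<open>The second derivatives lie in the span of \<open>f\<close> and \<open>n\<close>,
    and both of these are orthogonal to \<open>Z n\<close>.\<close>
  have ZN: "inner (ux p) (Z (n p)) = 0" "inner (w p) (Z (n p)) = 0" "inner (vy p) (Z (n p)) = 0"
    if p: "p \<in> S" for p
    by (simp_all add: uxe[OF p] we[OF p] vye[OF p] inner_add_left inner_diff_left Zn[OF p])
  have "\<exists>b. \<forall>p\<in>S. inner (Z (u p)) (D (f p)) = b"
  proof (rule zero_partials_constant[OF coord conn])
    fix p assume p: "p \<in> S"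
    have "inner (Z (u p)) (D (v p)) = 0"
      using ZN[OF p] by (simp add: ny[OF p] wZ[OF p, symmetric])
    then show "has_partials S z (\<lambda>p. inner (Z (u p)) (D (f p))) p 0 0"
      using has_partials_inner[OF coord has_partials_linear[OF blZ hu[OF p]] has_partials_linear[OF blD hf[OF p]] p]
      by (simp add: skew0 skew[of "ux p"] skew[of "w p"] n_def[symmetric] ZN[OF p])
  qed
  then obtain b where b: "\<And>p. p \<in> S \<Longrightarrow> B p = b"
    by (auto simp: B_def n_def wZ)
  \<comment> \<open>The component of \<open>vy\<close> is used instead of that of \<open>ux\<close>
    because \<open>vy = Z v\<close> has the form needed for differentiation; harmonicity turns it
    into \<open>- A p\<close>.\<close>
  have "\<exists>a. \<forall>p\<in>S. inner (Z (v p)) (D (f p)) = a"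
  proof (rule zero_partials_constant[OF coord conn])
    fix p assume p: "p \<in> S"
    have "inner (Z (v p)) (D (u p)) = inner (Z (D (v p))) (u p)" by (simp add: symm comm[symmetric])
    also have "\<dots> = - inner (w p) (Z (n p))"
      unfolding ny[OF p] wZ[OF p] skew[of "Z (n p)"] by (simp add: inner_commute)
    finally have "inner (Z (v p)) (D (u p)) = 0" using ZN[OF p] by simp
    then show "has_partials S z (\<lambda>p. inner (Z (v p)) (D (f p))) p 0 0"
      using has_partials_inner[OF coord has_partials_linear[OF blZ hv[OF p]] has_partials_linear[OF blD hf[OF p]] p]
      by (simp add: skew0 skew[of "vy p"] skew[of "w p"] n_def[symmetric] ZN[OF p])
  qed
  then obtain a' where a': "\<And>p. p \<in> S \<Longrightarrow> inner (vy p) (n p) = a'"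
    by (auto simp: n_def vyZ)
  define a where "a = - a'"
  have a: "A p = a" if p: "p \<in> S" for p
    using a'[OF p] by (simp add: vye[OF p] a_def inner_diff_left fo[OF p] nn[OF p])
  have st: "structure_equations S z k l a b f u v n"
    unfolding structure_equations_def
    using kl fr ff uu l nn hf hu hv hn uxe we vye a b by metis
  have "a\<^sup>2 + b\<^sup>2 = k * l"
  proof -
    let ?p = p0
    have "has_partials S z (\<lambda>p. (2 * \<epsilon> / l) *\<^sub>R v p + \<tau> *\<^sub>R n p) ?p
       ((2 * \<epsilon> / l) *\<^sub>R (b *\<^sub>R n ?p) + \<tau> *\<^sub>R (- (a / k) *\<^sub>R u ?p - (b / l) *\<^sub>R v ?p))
       ((2 * \<epsilon> / l) *\<^sub>R vy ?p + \<tau> *\<^sub>R (- (b / k) *\<^sub>R u ?p + (a / l) *\<^sub>R v ?p))"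
      using hv[OF p0] we[OF p0] b[OF p0]
      by (intro has_partials_add has_partials_scaleR structure_equations_normal[OF coord st p0]) simp
    moreover have "(2 * \<epsilon> / l) *\<^sub>R v p + \<tau> *\<^sub>R n p = R (f p)" if "p \<in> S" for p
      using Rn[OF that] by (simp add: algebra_simps)
    ultimately have "R (u ?p) = (2 * \<epsilon> / l) *\<^sub>R (b *\<^sub>R n ?p) + \<tau> *\<^sub>R (- (a / k) *\<^sub>R u ?p - (b / l) *\<^sub>R v ?p)"
      using un[OF hRf[OF p0] tr[OF _ p0]] by blast
    then have "k = inner ((2 * \<epsilon> / l) *\<^sub>R (b *\<^sub>R n ?p) + \<tau> *\<^sub>R (- (a / k) *\<^sub>R u ?p - (b / l) *\<^sub>R v ?p))
       ((2 * \<epsilon> / l) *\<^sub>R (b *\<^sub>R n ?p) + \<tau> *\<^sub>R (- (a / k) *\<^sub>R u ?p - (b / l) *\<^sub>R v ?p))"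
      using RR[of "u ?p" "u ?p"] uu[OF p0] by simp
    also have "\<dots> = (2 * \<epsilon> * b / l)\<^sup>2 + (\<tau> * \<tau>) * ((a / k)\<^sup>2 * k + (b / l)\<^sup>2 * l)"
      using fo[OF p0] uv[OF p0]
      by (simp add: inner_add_left inner_add_right inner_diff_left inner_diff_right nn[OF p0] uu[OF p0] l[OF p0]
          inner_commute[of "v ?p" "u ?p"] power2_eq_square algebra_simps)
    also have "\<dots> = (a\<^sup>2 + b\<^sup>2) / l"
    proof -
      have "(2 * \<epsilon> * b / l)\<^sup>2 = 4 * b\<^sup>2 / l\<^sup>2" by (simp add: power_divide power_mult_distrib e)
      moreover have "(\<tau> * \<tau>) * ((a / k)\<^sup>2 * k + (b / l)\<^sup>2 * l) = a\<^sup>2 / l + k * b\<^sup>2 / l\<^sup>2"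
        using kl unfolding \<tau> by (simp add: field_simps power2_eq_square)
      moreover have "4 * b\<^sup>2 / l\<^sup>2 + (a\<^sup>2 / l + k * b\<^sup>2 / l\<^sup>2) = (a\<^sup>2 + b\<^sup>2) / l"
      proof -
        have "4 * b\<^sup>2 / l\<^sup>2 + k * b\<^sup>2 / l\<^sup>2 = l * b\<^sup>2 / l\<^sup>2" by (simp add: k_def algebra_simps add_divide_distrib[symmetric])
        also have "\<dots> = b\<^sup>2 / l" using kl by (simp add: power2_eq_square)
        finally show ?thesis by (simp add: add_divide_distrib)
      qed
      ultimately show ?thesis by simp
    qed
    finally show ?thesis using kl by (simp add: field_simps)
  qed
  moreover have "l = k + 4" by (simp add: k_def)
  ultimately show ?thesis using st by blast
qed


section \<open>Rotating vectors and the explicit family\<close>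

text \<open>
  Under $\mathbb{R}^4 = \mathbb{C}^2$ this is $((p + iq) e^{iA}, (r + is) e^{iB})$, a form preserved by
  differentiation.
\<close>

definition torus_vec ::
  "real \<Rightarrow> real \<Rightarrow> real \<Rightarrow> real \<Rightarrow> real \<Rightarrow> real \<Rightarrow> real \<Rightarrow> real \<Rightarrow> complex \<Rightarrow> real^4" where
  "torus_vec a b c d p q r s w =
     (let A = a * Re w + b * Im w; B = c * Re w + d * Im w in
      vector [p * cos A - q * sin A, q * cos A + p * sin A, r * cos B - s * sin B, s * cos B + r * sin B])"

lemma torus_vec_linear:
  "x *\<^sub>R torus_vec a b c d p q r s w = torus_vec a b c d (x * p) (x * q) (x * r) (x * s) w"
  "torus_vec a b c d p q r s w + torus_vec a b c d p' q' r' s' w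
     = torus_vec a b c d (p + p') (q + q') (r + r') (s + s') w"
  "torus_vec a b c d p q r s w - torus_vec a b c d p' q' r' s' w
     = torus_vec a b c d (p - p') (q - q') (r - r') (s - s') w"
  by (simp_all add: torus_vec_def Let_def vec_eq_iff forall_4 algebra_simps)

lemma inner_torus_vec:
  "inner (torus_vec a b c d p q r s w) (torus_vec a b c d p' q' r' s' w) = p * p' + q * q' + r * r' + s * s'"
proof -
  have *: "(p * cos t - q * sin t) * (p' * cos t - q' * sin t) + (q * cos t + p * sin t) * (q' * cos t + p' * sin t)
    = p * p' + q * q'" for t p q p' q' :: real
  proof -
    have "(p * x - q * y) * (p' * x - q' * y) + (q * x + p * y) * (q' * x + p' * y)
      = (p * p' + q * q') * (x\<^sup>2 + y\<^sup>2)" for x y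
      by (simp add: algebra_simps power2_eq_square)
    then show ?thesis by (simp only: sin_cos_squared_add2 mult_1_right)
  qed
  show ?thesis
    using *[of p "a * Re w + b * Im w" q p' q'] *[of r "c * Re w + d * Im w" s r' s']
    by (simp add: torus_vec_def Let_def inner_vec_def sum_4)
qed

lemma torus_vec_has_derivative:
  "(torus_vec a b c d p q r s has_derivative
     (\<lambda>h. Re h *\<^sub>R torus_vec a b c d (- a * q) (a * p) (- c * s) (c * r) w
        + Im h *\<^sub>R torus_vec a b c d (- b * q) (b * p) (- d * s) (d * r) w)) (at w)"
proof -
  have eq: "torus_vec a b c d p q r s = (\<lambda>w. cos (a * Re w + b * Im w) *\<^sub>R vector [p, q, 0, 0]
     + sin (a * Re w + b * Im w) *\<^sub>R vector [- q, p, 0, 0]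
     + cos (c * Re w + d * Im w) *\<^sub>R vector [0, 0, r, s]
     + sin (c * Re w + d * Im w) *\<^sub>R vector [0, 0, - s, r])"
    by (simp add: fun_eq_iff torus_vec_def Let_def vec_eq_iff forall_4)
  show ?thesis
    unfolding eq
    by (rule derivative_eq_intros bounded_linear_Re bounded_linear_Im refl
          bounded_linear.has_derivative[OF bounded_linear_Re] bounded_linear.has_derivative[OF bounded_linear_Im])+
       (simp add: fun_eq_iff torus_vec_def Let_def vec_eq_iff forall_4 algebra_simps)
qed

lemma torus_map_eq:
  "torus_map r s \<phi> \<theta> = torus_vec (2 / r * sinh \<phi> * cos \<theta>) (- (2 / r) * cosh \<phi> * sin \<theta>)
      (2 / s * sinh \<phi> * sin \<theta>) (2 / s * cosh \<phi> * cos \<theta>) r 0 s 0"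
  by (simp add: fun_eq_iff torus_map_def torus_vec_def Let_def)

text \<open>In complex notation f is (r e^{iA}, s e^{iB}) and n is (s e^{iA}, -r e^{iB}). Second
  derivatives have real multiples of e^{iA} and e^{iB} in the two slots, hence are combinations of f
  and n. Equality of a^2 + b^2 and c^2 + d^2 makes the Laplacian of f a multiple of f; the other
  condition is orthogonality of f_x and f_y.\<close>

lemma torus_vec_structure:
  assumes coord: "complex_coordinate S z"
    and rs: "r\<^sup>2 + s\<^sup>2 = 1" and abcd: "a\<^sup>2 + b\<^sup>2 = c\<^sup>2 + d\<^sup>2" "a * b * r\<^sup>2 + c * d * s\<^sup>2 = 0"
    and k: "k = a\<^sup>2 * r\<^sup>2 + c\<^sup>2 * s\<^sup>2" "k > 0" and l: "l = b\<^sup>2 * r\<^sup>2 + d\<^sup>2 * s\<^sup>2" "l > 0"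
    and pq: "p = r * s * (c\<^sup>2 - a\<^sup>2)" "q = r * s * (c * d - a * b)"
  shows "structure_equations S z k l p q
     (\<lambda>x. torus_vec a b c d r 0 s 0 (z x)) (\<lambda>x. torus_vec a b c d 0 (a * r) 0 (c * s) (z x))
     (\<lambda>x. torus_vec a b c d 0 (b * r) 0 (d * s) (z x)) (\<lambda>x. torus_vec a b c d s 0 (- r) 0 (z x))"
proof -
  have hp: "x \<in> S \<Longrightarrow> u = torus_vec a b c d (- a * q') (a * p') (- c * s') (c * r') (z x) \<Longrightarrow>
      v = torus_vec a b c d (- b * q') (b * p') (- d * s') (d * r') (z x) \<Longrightarrow>
      has_partials S z (\<lambda>x. torus_vec a b c d p' q' r' s' (z x)) x u v" for x p' q' r' s' u v
    by (simp only:) (rule has_partials_plane[OF coord torus_vec_has_derivative])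
  have i: "r * r + s * s = 1" using rs by (simp add: power2_eq_square)
  have o: "a * r * (b * r) + c * s * (d * s) = 0" using abcd(2) by (simp add: power2_eq_square algebra_simps)
  have k': "a * r * (a * r) + c * s * (c * s) = k" and l': "b * r * (b * r) + d * s * (d * s) = l"
    by (simp_all add: k l power2_eq_square algebra_simps)
  have nz: "torus_vec a b c d p' q' r' s' w \<noteq> 0" if "p' * p' + q' * q' + r' * r' + s' * s' \<noteq> 0" for p' q' r' s' w
    using that inner_torus_vec[of a b c d p' q' r' s' w p' q' r' s'] by auto
  have e1: "- a * (a * r) = - k * r + p * s" "- c * (c * s) = - k * s - p * r"
    "- b * (a * r) = q * s" "- d * (c * s) = - q * r"
  proof -
    have cd: "c * d * s\<^sup>2 = - (a * b * r\<^sup>2)" using abcd(2) by simp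
    have "- k * r + p * s = - r * a\<^sup>2 * (r\<^sup>2 + s\<^sup>2)"
      by (simp add: k pq algebra_simps power2_eq_square)
    then show "- a * (a * r) = - k * r + p * s" unfolding rs by (simp add: power2_eq_square)
    have "- k * s - p * r = - s * c\<^sup>2 * (r\<^sup>2 + s\<^sup>2)"
      by (simp add: k pq algebra_simps power2_eq_square)
    then show "- c * (c * s) = - k * s - p * r" unfolding rs by (simp add: power2_eq_square)
    have "q * s = r * (c * d * s\<^sup>2) - r * a * b * s\<^sup>2" by (simp add: pq algebra_simps power2_eq_square)
    also have "\<dots> = - r * a * b * (r\<^sup>2 + s\<^sup>2)"
      unfolding cd by (simp add: algebra_simps)
    finally show "- b * (a * r) = q * s" unfolding rs by (simp add: algebra_simps)
    have "- q * r = - s * (- (a * b * r\<^sup>2)) - s * c * d * r\<^sup>2" by (simp add: pq algebra_simps power2_eq_square)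
    also have "\<dots> = - s * c * d * (r\<^sup>2 + s\<^sup>2)"
      unfolding cd[symmetric] by (simp add: algebra_simps)
    finally show "- d * (c * s) = - q * r" unfolding rs by (simp add: algebra_simps)
  qed
  have e2: "- b * (b * r) = - l * r - p * s" "- d * (d * s) = - l * s + p * r"
  proof -
    have p': "p = r * s * (b\<^sup>2 - d\<^sup>2)" 
    proof -
      have "c\<^sup>2 - a\<^sup>2 = b\<^sup>2 - d\<^sup>2" using abcd(1) by simp
      then show ?thesis by (simp add: pq)
    qed
    have "- l * r - p * s = - r * b\<^sup>2 * (r\<^sup>2 + s\<^sup>2)"
      by (simp add: l p' algebra_simps power2_eq_square)
    then show "- b * (b * r) = - l * r - p * s" unfolding rs by (simp add: power2_eq_square)
    have "- l * s + p * r = - s * d\<^sup>2 * (r\<^sup>2 + s\<^sup>2)"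
      by (simp add: l p' algebra_simps power2_eq_square)
    then show "- d * (d * s) = - l * s + p * r" unfolding rs by (simp add: power2_eq_square)
  qed
  have e3: "a * (b * r) = - q * s" "c * (d * s) = q * r"
    using e1(3,4) by (simp_all add: mult.left_commute)
  show ?thesis
    unfolding structure_equations_def
  proof (intro conjI ballI)
    fix x assume x: "x \<in> S"
    show "orthogonal_frame (torus_vec a b c d r 0 s 0 (z x)) (torus_vec a b c d 0 (a * r) 0 (c * s) (z x))
       (torus_vec a b c d 0 (b * r) 0 (d * s) (z x)) (torus_vec a b c d s 0 (- r) 0 (z x))"
      unfolding orthogonal_frame_def inner_torus_vec
      by (intro conjI nz) (use i o k' l' k l in \<open>simp_all add: add.commute\<close>)
    show "\<exists>c' d'. has_partials S z (\<lambda>x. torus_vec a b c d s 0 (- r) 0 (z x)) x c' d'"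
      using hp[OF x refl refl] by blast
    show "has_partials S z (\<lambda>x. torus_vec a b c d 0 (a * r) 0 (c * s) (z x)) x
        (- k *\<^sub>R torus_vec a b c d r 0 s 0 (z x) + p *\<^sub>R torus_vec a b c d s 0 (- r) 0 (z x))
        (q *\<^sub>R torus_vec a b c d s 0 (- r) 0 (z x))"
      by (rule hp[OF x]) (use e1 in \<open>simp_all add: torus_vec_linear\<close>)
    show "has_partials S z (\<lambda>x. torus_vec a b c d 0 (b * r) 0 (d * s) (z x)) x
        (q *\<^sub>R torus_vec a b c d s 0 (- r) 0 (z x))
        (- l *\<^sub>R torus_vec a b c d r 0 s 0 (z x) - p *\<^sub>R torus_vec a b c d s 0 (- r) 0 (z x))"
      by (rule hp[OF x]) (use e1 e2 e3 in \<open>simp_all add: torus_vec_linear\<close>)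
    show "has_partials S z (\<lambda>x. torus_vec a b c d r 0 s 0 (z x)) x
        (torus_vec a b c d 0 (a * r) 0 (c * s) (z x)) (torus_vec a b c d 0 (b * r) 0 (d * s) (z x))"
      by (rule hp[OF x]) simp_all
  qed (use i k' l' k l in \<open>simp_all add: inner_torus_vec add.commute\<close>)
qed

text \<open>Both partials keep the frequencies and change only the amplitudes, so the induction runs
  over all amplitudes at once.\<close>

lemma Ck_map_torus_vec: "Ck_map k UNIV (\<lambda>w. w) (torus_vec a b c d p q r s)"
proof (induction k arbitrary: p q r s)
  case 0
  have "continuous (at w) (torus_vec a b c d p q r s)" for w
    using torus_vec_has_derivative has_derivative_continuous by blast
  then show ?case by (simp add: continuous_at_imp_continuous_on)
next
  case (Suc k)
  have hp: "has_partials UNIV (\<lambda>w. w) (torus_vec a b c d p q r s) w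
      (torus_vec a b c d (- a * q) (a * p) (- c * s) (c * r) w)
      (torus_vec a b c d (- b * q) (b * p) (- d * s) (d * r) w)" for w
    using has_partials_plane[OF complex_coordinate_plane torus_vec_has_derivative, of w] by simp
  have "dx UNIV (\<lambda>w. w) (torus_vec a b c d p q r s) = torus_vec a b c d (- a * q) (a * p) (- c * s) (c * r)"
    "dy UNIV (\<lambda>w. w) (torus_vec a b c d p q r s) = torus_vec a b c d (- b * q) (b * p) (- d * s) (d * r)"
    using has_partials_dx[OF hp] has_partials_dy[OF hp] by auto
  with Suc hp show ?case
    by (simp add: has_partials_def differentiable_def) blast
qed

text \<open>The condition on \<theta> says cos 2\<theta> = (s^2 - r^2) cosh 2\<phi>, which is
  exactly what makes a^2 + b^2 and c^2 + d^2 equal, both being 4 cosh 2\<phi>. The last two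
  conclusions say that the transform has the same moduli |r| and |s| in its complex slots as the map
  itself.\<close>

lemma admissible_torus:
  assumes "admissible r s \<phi> \<theta>"
  defines "a \<equiv> 2 / r * sinh \<phi> * cos \<theta>" and "b \<equiv> - (2 / r) * cosh \<phi> * sin \<theta>"
    and "c \<equiv> 2 / s * sinh \<phi> * sin \<theta>" and "d \<equiv> 2 / s * cosh \<phi> * cos \<theta>"
  shows "a\<^sup>2 + b\<^sup>2 = c\<^sup>2 + d\<^sup>2" "a * b * r\<^sup>2 + c * d * s\<^sup>2 = 0"
    "a\<^sup>2 * r\<^sup>2 + c\<^sup>2 * s\<^sup>2 = 4 * (sinh \<phi>)\<^sup>2" "b\<^sup>2 * r\<^sup>2 + d\<^sup>2 * s\<^sup>2 = 4 * (cosh \<phi>)\<^sup>2"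
    "r * s * (c\<^sup>2 - a\<^sup>2) = (r\<^sup>2 - s\<^sup>2) * (sinh (2 * \<phi>))\<^sup>2 / (r * s)"
    "r * s * (c * d - a * b) = sinh (2 * \<phi>) * sqrt (1 - (r\<^sup>2 - s\<^sup>2)\<^sup>2 * (cosh (2 * \<phi>))\<^sup>2) / (r * s)"
    "r * s * (a * d - b * c) = 2 * sinh (2 * \<phi>)"
    "(b * r)\<^sup>2 + s\<^sup>2 * (sinh (2 * \<phi>))\<^sup>2 = 4 * r\<^sup>2 * (cosh \<phi>)^4"
    "(d * s)\<^sup>2 + r\<^sup>2 * (sinh (2 * \<phi>))\<^sup>2 = 4 * s\<^sup>2 * (cosh \<phi>)^4"
proof -
  define X where "X = (s\<^sup>2 - r\<^sup>2) * cosh (2 * \<phi>)"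
  have nz: "r \<noteq> 0" "s \<noteq> 0" and rs: "r\<^sup>2 + s\<^sup>2 = 1" and X1: "\<bar>X\<bar> \<le> 1" and th: "\<theta> = arccos X / 2"
    using assms(1) by (auto simp: admissible_def X_def)
  define h where "h = sinh \<phi>"
  define g where "g = cosh \<phi>"
  have g2: "g\<^sup>2 = 1 + h\<^sup>2" by (simp add: g_def h_def cosh_square_eq)
  have s2: "s\<^sup>2 = 1 - r\<^sup>2" using rs by simp
  have c2: "cosh (2 * \<phi>) = 1 + 2 * h\<^sup>2" using g2 by (simp add: cosh_double h_def g_def)
  have sh2: "sinh (2 * \<phi>) = 2 * h * g" by (simp add: sinh_double h_def g_def)
  have X: "X = cos (2 * \<theta>)" using X1 by (simp add: th cos_arccos_abs)
  have ct: "(cos \<theta>)\<^sup>2 = (1 + X) / 2" and st: "(sin \<theta>)\<^sup>2 = (1 - X) / 2"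
    unfolding X cos_double_cos sin_squared_eq by simp_all
  \<comment> \<open>The range of \<open>arccos\<close> makes \<open>sin (2 * \<theta>)\<close> the
    nonnegative root, which fixes the sign of the mixed coefficient.\<close>
  have "0 \<le> arccos X" "arccos X \<le> pi" using X1 by (auto intro: arccos_lbound arccos_ubound)
  then have "sin (2 * \<theta>) = sqrt (1 - X\<^sup>2)" using X1 by (simp add: th sin_arccos_abs)
  moreover have "X\<^sup>2 = (r\<^sup>2 - s\<^sup>2)\<^sup>2 * (cosh (2 * \<phi>))\<^sup>2"
    by (simp add: X_def power_mult_distrib power2_commute)
  ultimately have s2t: "sqrt (1 - (r\<^sup>2 - s\<^sup>2)\<^sup>2 * (cosh (2 * \<phi>))\<^sup>2) = 2 * sin \<theta> * cos \<theta>"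
    by (simp add: sin_double)
  have XX: "X = (1 - 2 * r\<^sup>2) * (1 + 2 * h\<^sup>2)" by (simp add: X_def c2 s2)
  have a2: "a\<^sup>2 = 4 * h\<^sup>2 * ((1 + X) / 2) / r\<^sup>2" and b2: "b\<^sup>2 = 4 * g\<^sup>2 * ((1 - X) / 2) / r\<^sup>2"
    and c2': "c\<^sup>2 = 4 * h\<^sup>2 * ((1 - X) / 2) / s\<^sup>2" and d2: "d\<^sup>2 = 4 * g\<^sup>2 * ((1 + X) / 2) / s\<^sup>2"
    by (simp_all add: a_def b_def c_def d_def h_def g_def power_mult_distrib power_divide ct st)
  have ab: "a * b = - 4 * h * g * (sin \<theta> * cos \<theta>) / r\<^sup>2" and cd: "c * d = 4 * h * g * (sin \<theta> * cos \<theta>) / s\<^sup>2"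
    by (simp_all add: a_def b_def c_def d_def h_def g_def power2_eq_square)
  have ra: "a\<^sup>2 * r\<^sup>2 = 2 * h\<^sup>2 * (1 + X)" "b\<^sup>2 * r\<^sup>2 = 2 * g\<^sup>2 * (1 - X)" "c\<^sup>2 * s\<^sup>2 = 2 * h\<^sup>2 * (1 - X)"
     "d\<^sup>2 * s\<^sup>2 = 2 * g\<^sup>2 * (1 + X)" 
    using nz by (simp_all add: a2 b2 c2' d2)
  have rab: "a * b * r\<^sup>2 = - 4 * h * g * (sin \<theta> * cos \<theta>)" "c * d * s\<^sup>2 = 4 * h * g * (sin \<theta> * cos \<theta>)"
    using nz by (simp_all add: ab cd)
  have "(a\<^sup>2 + b\<^sup>2) * r\<^sup>2 = 4 * (1 + 2 * h\<^sup>2) * r\<^sup>2"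
    unfolding distrib_right ra by (simp add: g2 XX) algebra
  moreover have "(c\<^sup>2 + d\<^sup>2) * s\<^sup>2 = 4 * (1 + 2 * h\<^sup>2) * s\<^sup>2"
    unfolding distrib_right ra by (simp add: g2 XX s2) algebra
  ultimately show "a\<^sup>2 + b\<^sup>2 = c\<^sup>2 + d\<^sup>2" using nz by simp
  show "a * b * r\<^sup>2 + c * d * s\<^sup>2 = 0" unfolding rab by simp
  show "a\<^sup>2 * r\<^sup>2 + c\<^sup>2 * s\<^sup>2 = 4 * (sinh \<phi>)\<^sup>2" unfolding ra h_def[symmetric] by algebra
  show "b\<^sup>2 * r\<^sup>2 + d\<^sup>2 * s\<^sup>2 = 4 * (cosh \<phi>)\<^sup>2" unfolding ra g_def[symmetric] by algebra
  have "r * s * (c\<^sup>2 - a\<^sup>2) * (r * s) = (c\<^sup>2 * s\<^sup>2) * r\<^sup>2 - (a\<^sup>2 * r\<^sup>2) * s\<^sup>2" by algebra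
  also have "\<dots> = (r\<^sup>2 - s\<^sup>2) * (2 * h * g)\<^sup>2"
    unfolding ra by (simp add: power_mult_distrib g2 XX s2) algebra
  finally show "r * s * (c\<^sup>2 - a\<^sup>2) = (r\<^sup>2 - s\<^sup>2) * (sinh (2 * \<phi>))\<^sup>2 / (r * s)"
    using nz unfolding sh2 by (metis nonzero_eq_divide_eq no_zero_divisors)
  have "r * s * (c * d - a * b) * (r * s) = (c * d * s\<^sup>2) * r\<^sup>2 - (a * b * r\<^sup>2) * s\<^sup>2" by algebra
  also have "\<dots> = (2 * h * g) * (2 * sin \<theta> * cos \<theta>)"
    unfolding rab by (simp add: s2) algebra
  finally show "r * s * (c * d - a * b) = sinh (2 * \<phi>) * sqrt (1 - (r\<^sup>2 - s\<^sup>2)\<^sup>2 * (cosh (2 * \<phi>))\<^sup>2) / (r * s)"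
    using nz unfolding sh2 s2t by (metis nonzero_eq_divide_eq no_zero_divisors)
  have adbc: "a * d = 4 * h * g * (cos \<theta>)\<^sup>2 / (r * s)" "b * c = - 4 * h * g * (sin \<theta>)\<^sup>2 / (r * s)"
    by (simp_all add: a_def b_def c_def d_def h_def g_def power2_eq_square)
  have "r * s * (a * d - b * c) = 4 * h * g * ((1 + X) / 2) + 4 * h * g * ((1 - X) / 2)"
    using nz unfolding adbc ct st by (simp add: field_simps)
  also have "\<dots> = 4 * h * g" by (simp add: field_simps)
  finally show "r * s * (a * d - b * c) = 2 * sinh (2 * \<phi>)" by (simp add: sh2)
  have g4: "g ^ 4 = (1 + h\<^sup>2)\<^sup>2" by (metis g2 power4_eq_xxxx power2_eq_square mult.assoc)
  have hg: "(2 * h * g)\<^sup>2 = 4 * h\<^sup>2 * (1 + h\<^sup>2)" by (simp add: power_mult_distrib g2)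
  have br: "(b * r)\<^sup>2 = 2 * g\<^sup>2 * (1 - X)" and ds: "(d * s)\<^sup>2 = 2 * g\<^sup>2 * (1 + X)"
    unfolding power_mult_distrib ra by simp_all
  show "(b * r)\<^sup>2 + s\<^sup>2 * (sinh (2 * \<phi>))\<^sup>2 = 4 * r\<^sup>2 * (cosh \<phi>)^4"
    unfolding br sh2 hg g_def[symmetric] g4 s2 g2 XX by algebra
  show "(d * s)\<^sup>2 + r\<^sup>2 * (sinh (2 * \<phi>))\<^sup>2 = 4 * s\<^sup>2 * (cosh \<phi>)^4"
    unfolding ds sh2 hg g_def[symmetric] g4 s2 g2 XX by algebra
qed

text \<open>With H = sinh 2\<phi> the hypothesis reads p^2 + q^2 = 4 H^2, and the bound in
  \<open>admissible\<close> reduces to q^2 >= 0.\<close>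

lemma admissible_exists:
  assumes k: "k > 0" and pq: "p\<^sup>2 + q\<^sup>2 = k * (k + 4)"
  shows "\<exists>r s \<phi> \<theta>. admissible r s \<phi> \<theta> \<and> k = 4 * (sinh \<phi>)\<^sup>2 \<and>
     p = (r\<^sup>2 - s\<^sup>2) * (sinh (2 * \<phi>))\<^sup>2 / (r * s) \<and>
     q = sinh (2 * \<phi>) * sqrt (1 - (r\<^sup>2 - s\<^sup>2)\<^sup>2 * (cosh (2 * \<phi>))\<^sup>2) / (r * s)"
proof -
  define \<phi> where "\<phi> = arsinh (sqrt k / 2)"
  have sh: "sinh \<phi> = sqrt k / 2" by (simp add: \<phi>_def)
  have \<phi>: "\<phi> > 0" using k sh by (metis divide_pos_pos real_sqrt_gt_zero sinh_real_pos_iff zero_less_numeral)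
  have ks: "k = 4 * (sinh \<phi>)\<^sup>2" using k by (simp add: sh power_divide)
  define H where "H = sinh (2 * \<phi>)"
  have H: "H > 0" using \<phi> by (simp add: H_def)
  have "4 * H\<^sup>2 = (4 * (sinh \<phi>)\<^sup>2) * (4 * (cosh \<phi>)\<^sup>2)" by (simp add: H_def sinh_double power_mult_distrib)
  also have "\<dots> = p\<^sup>2 + q\<^sup>2" using pq unfolding ks by (simp add: cosh_square_eq algebra_simps)
  finally have H2: "p\<^sup>2 + q\<^sup>2 = 4 * H\<^sup>2" by simp
  have C2: "(cosh (2 * \<phi>))\<^sup>2 = 1 + H\<^sup>2" by (simp add: H_def cosh_square_eq)
  txt \<open>
    With $r = \cos t$ and $s = \sigma \sin t$ the equation for \<open>p\<close> reads $\cot 2t = m$; the sign $\sigma$ of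
    $rs$ has to be that of \<open>q\<close>.
  \<close>
  define \<sigma> :: real where "\<sigma> = (if q \<ge> 0 then 1 else -1)"
  have \<sigma>: "\<sigma> * \<sigma> = 1" "\<sigma> \<noteq> 0" "\<sigma> * \<bar>q\<bar> = q" by (auto simp: \<sigma>_def)
  define m where "m = \<sigma> * p / (2 * H\<^sup>2)"
  have m2: "m\<^sup>2 * H\<^sup>2 = p\<^sup>2 / (4 * H\<^sup>2)"
    using H \<sigma> by (simp add: m_def power_divide power_mult_distrib power2_eq_square[of \<sigma>])
      (simp add: power2_eq_square power4_eq_xxxx)
  have mH: "1 - m\<^sup>2 * H\<^sup>2 = q\<^sup>2 / (4 * H\<^sup>2)"
    using H H2 unfolding m2 by (simp add: field_simps)
  \<comment> \<open>This \<open>t\<close> is not the angle above but the cosecant of its double,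
    whose cotangent is \<open>m\<close>. \<open>w\<close> is the cosine of the doubled angle and
    becomes \<open>r\<^sup>2 - s\<^sup>2\<close>.\<close>
  define t where "t = sqrt (1 + m\<^sup>2)"
  have t: "t > 0" "t\<^sup>2 = 1 + m\<^sup>2" by (auto simp: t_def add_pos_nonneg)
  define w where "w = m / t"
  have w2: "w\<^sup>2 = m\<^sup>2 / t\<^sup>2" by (simp add: w_def power_divide)
  have w1: "1 - w\<^sup>2 = 1 / t\<^sup>2"
  proof -
    have "1 - w\<^sup>2 = (t\<^sup>2 - m\<^sup>2) / t\<^sup>2" using t(1) by (simp add: w2 diff_divide_distrib)
    then show ?thesis by (simp add: t(2))
  qed
  then have "w\<^sup>2 < 1" using t by (metis diff_gt_0_iff_gt zero_less_divide_1_iff zero_less_power)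
  then have w: "- 1 < w" "w < 1" by (auto simp: abs_square_less_1)
  define r where "r = sqrt ((1 + w) / 2)"
  define s where "s = \<sigma> * sqrt ((1 - w) / 2)"
  have r2: "r\<^sup>2 = (1 + w) / 2" and s2: "s\<^sup>2 = (1 - w) / 2"
    using w \<sigma> by (simp_all add: r_def s_def power_mult_distrib power2_eq_square[of \<sigma>])
  have nz: "r \<noteq> 0" "s \<noteq> 0" using w \<sigma> by (auto simp: r_def s_def)
  have d: "r\<^sup>2 - s\<^sup>2 = w" "s\<^sup>2 - r\<^sup>2 = - w" "r\<^sup>2 + s\<^sup>2 = 1" unfolding r2 s2 by (simp_all add: field_simps)
  have rs: "r * s = \<sigma> / (2 * t)"
  proof -
    have "r * s = \<sigma> * sqrt ((1 - w\<^sup>2) / 4)"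
      by (simp add: r_def s_def real_sqrt_mult[symmetric] power2_eq_square algebra_simps)
    also have "(1 - w\<^sup>2) / 4 = (1 / (2 * t))\<^sup>2" by (simp add: w1 power_divide power_mult_distrib)
    finally show ?thesis using t by simp
  qed
  have wC: "1 - w\<^sup>2 * (cosh (2 * \<phi>))\<^sup>2 = (\<bar>q\<bar> / (2 * H * t))\<^sup>2"
  proof -
    have "1 - w\<^sup>2 * (cosh (2 * \<phi>))\<^sup>2 = (t\<^sup>2 - m\<^sup>2 * (1 + H\<^sup>2)) / t\<^sup>2"
      using t(1) unfolding w2 C2 by (simp add: diff_divide_distrib)
    also have "\<dots> = (1 - m\<^sup>2 * H\<^sup>2) / t\<^sup>2" by (simp add: t(2) algebra_simps)
    finally have "1 - w\<^sup>2 * (cosh (2 * \<phi>))\<^sup>2 = (1 - m\<^sup>2 * H\<^sup>2) / t\<^sup>2" .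
    then show ?thesis by (simp add: mH power_divide power_mult_distrib)
  qed
  define \<theta> where "\<theta> = arccos ((s\<^sup>2 - r\<^sup>2) * cosh (2 * \<phi>)) / 2"
  have "w\<^sup>2 * (cosh (2 * \<phi>))\<^sup>2 \<le> 1" using wC by (metis diff_ge_0_iff_ge zero_le_power2)
  then have "\<bar>w * cosh (2 * \<phi>)\<bar> \<le> 1" by (simp add: abs_square_le_1[symmetric] power_mult_distrib)
  then have adm: "admissible r s \<phi> \<theta>"
    using nz d \<phi> by (simp add: admissible_def \<theta>_def)
  have "p = w * H\<^sup>2 / (r * s)"
    using H t \<sigma> unfolding rs by (simp add: w_def m_def power2_eq_square field_simps)
  moreover have "q = H * sqrt (1 - w\<^sup>2 * (cosh (2 * \<phi>))\<^sup>2) / (r * s)"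
  proof -
    have "H * sqrt (1 - w\<^sup>2 * (cosh (2 * \<phi>))\<^sup>2) / (r * s) = \<bar>q\<bar> / \<sigma>"
      using H t unfolding wC rs real_sqrt_abs by simp
    also have "\<dots> = q" using \<sigma> by (metis nonzero_mult_div_cancel_left mult.assoc mult_1 divide_divide_eq_right div_by_1 nonzero_eq_divide_eq mult.commute)
    finally show ?thesis ..
  qed
  ultimately show ?thesis
    using adm ks d(1) H_def by blast
qed


section \<open>Quaternions, transforms and complexified derivatives\<close>

text \<open>The sign is chosen so that for $f = 1$ and imaginary \<open>u\<close>, \<open>v\<close> this is $u \times v$.\<close>

definition triple_cross :: "real^4 \<Rightarrow> real^4 \<Rightarrow> real^4 \<Rightarrow> real^4" where
  "triple_cross f u v = vector
     [- (f$2 * (u$3 * v$4 - u$4 * v$3) - f$3 * (u$2 * v$4 - u$4 * v$2) + f$4 * (u$2 * v$3 - u$3 * v$2)),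
      f$1 * (u$3 * v$4 - u$4 * v$3) - f$3 * (u$1 * v$4 - u$4 * v$1) + f$4 * (u$1 * v$3 - u$3 * v$1),
      - (f$1 * (u$2 * v$4 - u$4 * v$2) - f$2 * (u$1 * v$4 - u$4 * v$1) + f$4 * (u$1 * v$2 - u$2 * v$1)),
      f$1 * (u$2 * v$3 - u$3 * v$2) - f$2 * (u$1 * v$3 - u$3 * v$1) + f$3 * (u$1 * v$2 - u$2 * v$1)]"

text \<open>Left multiplication by \<open>f\<close> is |f| times a rotation, so the triple product
  scales by |f|^3, one factor of which is already in the quaternion product. The normal can thus be
  computed from f, f_x, f_y without \<alpha> and \<beta>.\<close>

lemma qmult_imq_cross3:
  "inner f f *\<^sub>R (f \<odot> imq (cross3 a b)) = triple_cross f (f \<odot> imq a) (f \<odot> imq b)"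
  by (simp add: triple_cross_def qmult_def imq_def cross3_def inner_vec_def sum_4 vec_eq_iff forall_4 algebra_simps)

lemma inner_triple_cross:
  "inner (triple_cross f u v) f = 0" "inner (triple_cross f u v) u = 0" "inner (triple_cross f u v) v = 0"
  by (simp_all add: triple_cross_def inner_vec_def sum_4 algebra_simps)

lemma inner_qmult_imq:
  "inner (f \<odot> imq a) (f \<odot> imq b) = inner f f * inner a b"
  by (simp add: qmult_def imq_def inner_vec_def sum_4 sum_3 algebra_simps)

lemma qmult_imq_linear:
  "f \<odot> imq (x *\<^sub>R a + y *\<^sub>R b) = x *\<^sub>R (f \<odot> imq a) + y *\<^sub>R (f \<odot> imq b)"
  by (simp add: qmult_def imq_def vec_eq_iff forall_4 algebra_simps)

text \<open>This gives meaning to the definite descriptions in \<open>alpha_of\<close> and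
  \<open>beta_of\<close>.\<close>

lemma ex1_qmult_imq:
  assumes "inner f f = 1" "inner f u = 0"
  shows "\<exists>!a. u = f \<odot> imq a"
proof (rule ex_ex1I)
  \<comment> \<open>The imaginary part of the conjugate of \<open>f\<close> times \<open>u\<close>;
    the real part is their inner product, which vanishes.\<close>
  let ?a = "vector [f$1 * u$2 - f$2 * u$1 - f$3 * u$4 + f$4 * u$3,
                    f$1 * u$3 + f$2 * u$4 - f$3 * u$1 - f$4 * u$2,
                    f$1 * u$4 - f$2 * u$3 + f$3 * u$2 - f$4 * u$1] :: real^3"
  have "f \<odot> imq ?a = inner f f *\<^sub>R u - inner f u *\<^sub>R f"
    by (simp add: qmult_def imq_def inner_vec_def sum_4 vec_eq_iff forall_4 algebra_simps vector_3)
  then show "\<exists>a. u = f \<odot> imq a" using assms by (intro exI[of _ ?a]) simp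
  fix a b assume "u = f \<odot> imq a" "u = f \<odot> imq b"
  then have "f \<odot> imq (1 *\<^sub>R a + (- 1) *\<^sub>R b) = 0" unfolding qmult_imq_linear by simp
  then have "inner (a - b) (a - b) = 0"
    using inner_qmult_imq[of f "a - b" "a - b"] assms(1) by simp
  then show "a = b" by simp
qed

lemma alpha_beta_of:
  assumes f: "has_partials S z f p u v" and "inner (f p) (f p) = 1" "inner (f p) u = 0" "inner (f p) v = 0"
  shows "f p \<odot> imq (alpha_of S z f p) = u" "f p \<odot> imq (beta_of S z f p) = v"
    "norm (alpha_of S z f p) = norm u" "norm (beta_of S z f p) = norm v"
    "f p \<odot> imq (cross3 (alpha_of S z f p) (beta_of S z f p)) = triple_cross (f p) u v"
proof -
  show a: "f p \<odot> imq (alpha_of S z f p) = u"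
    using theI'[OF ex1_qmult_imq[OF assms(2,3)]] by (simp add: alpha_of_def has_partials_dx[OF f])
  show b: "f p \<odot> imq (beta_of S z f p) = v"
    using theI'[OF ex1_qmult_imq[OF assms(2,4)]] by (simp add: beta_of_def has_partials_dy[OF f])
  show "norm (alpha_of S z f p) = norm u" "norm (beta_of S z f p) = norm v"
    using inner_qmult_imq[of "f p" "alpha_of S z f p" "alpha_of S z f p"]
      inner_qmult_imq[of "f p" "beta_of S z f p" "beta_of S z f p"]
    by (simp_all add: a b assms(2) norm_eq_sqrt_inner)
  show "f p \<odot> imq (cross3 (alpha_of S z f p) (beta_of S z f p)) = triple_cross (f p) u v"
    using qmult_imq_cross3[of "f p" "alpha_of S z f p" "beta_of S z f p"] assms(2) by (simp add: a b)
qed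

lemma phi_of_eqI:
  assumes "norm (alpha_of S z f p) = 2 * sinh t" "norm (beta_of S z f p) = 2 * cosh t" "0 \<le> t"
  shows "phi_of S z f p = t"
  unfolding phi_of_def by (rule the_equality) (use assms in auto)

lemma eps_transform_eq:
  assumes f: "has_partials S z f p u v" and "inner (f p) (f p) = 1" "inner (f p) u = 0" "inner (f p) v = 0"
  shows "eps_transform \<epsilon> S z f p = (1 / (2 * (cosh (phi_of S z f p))\<^sup>2)) *\<^sub>R
     (\<epsilon> *\<^sub>R v + (1/2) *\<^sub>R triple_cross (f p) u v)"
  unfolding eps_transform_def qmult_imq_linear alpha_beta_of[OF assms] ..

section \<open>Complexified vectors and Wirtinger derivatives\<close>

lemma bounded_linear_cvec: "bounded_linear (cvec :: real^'n \<Rightarrow> complex^'n)"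
  by (rule linear_conv_bounded_linear[THEN iffD1])
     (auto intro!: linearI simp: cvec_def vec_eq_iff scaleR_conv_of_real[where 'a=complex])

lemma bounded_linear_vector_scalar_mult: "bounded_linear (\<lambda>x :: complex^'n. c *s x)"
  by (rule linear_conv_bounded_linear[THEN iffD1])
     (auto intro!: linearI simp: vec_eq_iff scaleR_conv_of_real[where 'a=complex] algebra_simps)

lemma cvec_linear:
  "cvec (x + y) = cvec x + cvec y" "cvec (x - y) = cvec x - cvec y" "cvec (- x) = - cvec x"
  "cvec (t *\<^sub>R x) = complex_of_real t *s cvec x"
  by (simp_all add: cvec_def vec_eq_iff)

lemma cbilin_cvec: "cbilin (cvec x) (cvec y) = complex_of_real (inner x y)"
  by (simp add: cbilin_def cvec_def inner_vec_def)

lemma cbilin_linear: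
  "cbilin (x + y) w = cbilin x w + cbilin y w" "cbilin w (x + y) = cbilin w x + cbilin w y"
  "cbilin (x - y) w = cbilin x w - cbilin y w" "cbilin w (x - y) = cbilin w x - cbilin w y"
  "cbilin (c *s x) w = c * cbilin x w" "cbilin w (c *s x) = c * cbilin w x"
  by (simp_all add: cbilin_def sum.distrib sum_subtractf sum_distrib_left algebra_simps)

lemma del_delbar_eq:
  assumes "has_partials S z f p u v"
  shows "del S z f p = (1/2) *s (cvec u - \<i> *s cvec v)" "delbar S z f p = (1/2) *s (cvec u + \<i> *s cvec v)"
  using has_partials_dx[OF has_partials_linear[OF bounded_linear_cvec assms]]
    has_partials_dy[OF has_partials_linear[OF bounded_linear_cvec assms]]
  by (simp_all add: dz_def dzbar_def)

lemma cbilin_del: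
  assumes "has_partials S z f p u v"
  shows "cbilin (del S z f p) (del S z f p)
      = Complex ((inner u u - inner v v) / 4) (- inner u v / 2)"
    "cbilin (del S z f p) (delbar S z f p) = of_real ((inner u u + inner v v) / 4)"
  by (simp_all add: del_delbar_eq[OF assms] cbilin_linear cbilin_cvec inner_commute[of v u] complex_eq_iff
      algebra_simps)

lemma dz_del_delbar:
  assumes coord: "complex_coordinate S z" and f: "\<And>q. q \<in> S \<Longrightarrow> has_partials S z f q (u q) (v q)"
    and p: "p \<in> S" and u: "has_partials S z u p ux uy" and v: "has_partials S z v p vx vy"
  shows "dz S z (del S z f) p = (1/4) *s (cvec ux - \<i> *s cvec vx - \<i> *s cvec uy - cvec vy)"
    "dz S z (delbar S z f) p = (1/4) *s (cvec ux + \<i> *s cvec vx - \<i> *s cvec uy + cvec vy)"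
proof -
  note c = has_partials_linear[OF bounded_linear_cvec u] has_partials_linear[OF bounded_linear_cvec v]
  note s = has_partials_linear[OF bounded_linear_vector_scalar_mult]
  have 1: "has_partials S z (del S z f) p ((1/2) *s (cvec ux - \<i> *s cvec vx)) ((1/2) *s (cvec uy - \<i> *s cvec vy))"
    by (rule has_partials_transform[OF coord s[OF has_partials_diff[OF c(1) s[OF c(2)]]] p])
       (simp add: del_delbar_eq[OF f])
  have 2: "has_partials S z (delbar S z f) p ((1/2) *s (cvec ux + \<i> *s cvec vx)) ((1/2) *s (cvec uy + \<i> *s cvec vy))"
    by (rule has_partials_transform[OF coord s[OF has_partials_add[OF c(1) s[OF c(2)]]] p])
       (simp add: del_delbar_eq[OF f])
  show "dz S z (del S z f) p = (1/4) *s (cvec ux - \<i> *s cvec vx - \<i> *s cvec uy - cvec vy)"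
    "dz S z (delbar S z f) p = (1/4) *s (cvec ux + \<i> *s cvec vx - \<i> *s cvec uy + cvec vy)"
    unfolding dz_def[of S z "del S z f"] dz_def[of S z "delbar S z f"]
      has_partials_dx[OF 1] has_partials_dy[OF 1] has_partials_dx[OF 2] has_partials_dy[OF 2]
    by (simp_all add: vec_eq_iff algebra_simps)
qed

lemma triple_cross_torus_vec:
  assumes "r\<^sup>2 + s\<^sup>2 = 1"
  shows "triple_cross (torus_vec a b c d r 0 s 0 w) (torus_vec a b c d 0 (a * r) 0 (c * s) w)
       (torus_vec a b c d 0 (b * r) 0 (d * s) w) = (r * s * (a * d - b * c)) *\<^sub>R torus_vec a b c d s 0 (- r) 0 w"
proof -
  define C where "C = cos (a * Re w + b * Im w)"
  define C' where "C' = cos (c * Re w + d * Im w)"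
  define D where "D = sin (a * Re w + b * Im w)"
  define D' where "D' = sin (c * Re w + d * Im w)"
  have 1: "C\<^sup>2 + D\<^sup>2 = 1" "C'\<^sup>2 + D'\<^sup>2 = 1" by (simp_all add: C_def D_def C'_def D'_def)
  have e: "torus_vec a b c d p q t o' w = vector [p * C - q * D, q * C + p * D, t * C' - o' * D', o' * C' + t * D']"
    for p q t o' by (simp add: torus_vec_def Let_def C_def D_def C'_def D'_def)
  show ?thesis
    unfolding e triple_cross_def vec_eq_iff forall_4 using 1 assms
    by (simp, intro conjI; algebra)
qed

text \<open>The normal parts of f_xx and f_yy cancel and the mixed derivatives agree, which is
  harmonicity; the difference 4 of the squared lengths is adaptedness.\<close>

lemma structure_equations_harmonic:
  assumes coord: "complex_coordinate S z" and st: "structure_equations S z k (k + 4) a b f u v n"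
    and smooth: "smooth_map S z f"
  shows "harmonic_map S z f" "adapted_coordinate S z f"
proof -
  have o: "orthogonal_frame (f p) (u p) (v p) (n p)" "inner (f p) (f p) = 1" "inner (u p) (u p) = k"
    "inner (v p) (v p) = k + 4" if "p \<in> S" for p
    using st that by (auto simp: structure_equations_def)
  have h: "has_partials S z f p (u p) (v p)" 
    "has_partials S z u p (- k *\<^sub>R f p + a *\<^sub>R n p) (b *\<^sub>R n p)"
    "has_partials S z v p (b *\<^sub>R n p) (- (k + 4) *\<^sub>R f p - a *\<^sub>R n p)" if "p \<in> S" for p
    using st that by (auto simp: structure_equations_def)
  show "adapted_coordinate S z f"
    unfolding adapted_coordinate_def
    using cbilin_del[OF h(1)] o by (auto simp: orthogonal_frame_def complex_eq_iff)
  show "harmonic_map S z f"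
    unfolding harmonic_map_def
  proof (intro conjI ballI smooth)
    show "f ` S \<subseteq> sphere 0 1" using o(2) by (auto simp: norm_eq_1)
    fix p assume p: "p \<in> S"
    have d: "dz S z (delbar S z f) p = (1/4) *s (cvec (- k *\<^sub>R f p + a *\<^sub>R n p) + \<i> *s cvec (b *\<^sub>R n p)
        - \<i> *s cvec (b *\<^sub>R n p) + cvec (- (k + 4) *\<^sub>R f p - a *\<^sub>R n p))"
      by (rule dz_del_delbar(2)[OF coord _ p h(2,3)[OF p]]) (rule h(1))
    show "dz S z (delbar S z f) p = - (cbilin (del S z f p) (delbar S z f p) *s cvec (f p))"
      unfolding d cbilin_del(2)[OF h(1)[OF p]] o(3,4)[OF p]
      by (simp add: vec_eq_iff cvec_linear field_simps)
  qed
qed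

lemma structure_equations_mu_of:
  assumes coord: "complex_coordinate S z" and st: "structure_equations S z k l a b f u v n"
    and p: "p \<in> S" and n: "normal_of S z f p = n p"
  shows "mu_of S z f p = (of_real a - \<i> * of_real b) / 2"
proof -
  have o: "orthogonal_frame (f p) (u p) (v p) (n p)" "inner (n p) (n p) = 1" 
    using st p by (auto simp: structure_equations_def)
  have h: "has_partials S z f p (u p) (v p)" 
    "has_partials S z u p (- k *\<^sub>R f p + a *\<^sub>R n p) (b *\<^sub>R n p)"
    "has_partials S z v p (b *\<^sub>R n p) (- l *\<^sub>R f p - a *\<^sub>R n p)" if "p \<in> S" for p
    using st that by (auto simp: structure_equations_def)
  have d: "dz S z (del S z f) p = (1/4) *s (cvec (- k *\<^sub>R f p + a *\<^sub>R n p) - \<i> *s cvec (b *\<^sub>R n p)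
      - \<i> *s cvec (b *\<^sub>R n p) - cvec (- l *\<^sub>R f p - a *\<^sub>R n p))"
    by (rule dz_del_delbar(1)[OF coord _ p h(2,3)[OF p]]) (rule h(1))
  show ?thesis
    using o unfolding mu_of_def n d cvec_linear cbilin_linear cbilin_cvec orthogonal_frame_def
    by (simp add: field_simps)
qed


section \<open>The classification\<close>

text \<open>The isometry multiplies the two complex slots by the unit numbers C + iT and C' + iT',
  which commute with the phases e^{iA} and e^{iB}.\<close>

lemma torus_vec_rotate:
  assumes "C\<^sup>2 + T\<^sup>2 = 1" "C'\<^sup>2 + T'\<^sup>2 = 1"
  shows "congruent_maps S (\<lambda>x. torus_vec a b c d p q r s (w x))
     (\<lambda>x. torus_vec a b c d (C * p - T * q) (T * p + C * q) (C' * r - T' * s) (T' * r + C' * s) (w x))"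
proof -
  let ?R = "\<lambda>x :: real^4. vector [C * x$1 - T * x$2, T * x$1 + C * x$2, C' * x$3 - T' * x$4, T' * x$3 + C' * x$4] :: real^4"
  have "orthogonal_transformation ?R"
    unfolding orthogonal_transformation_def
  proof (intro conjI allI)
    show "linear ?R" by (intro linearI) (simp_all add: vec_eq_iff forall_4 algebra_simps)
    fix x y :: "real^4"
    have "inner (?R x) (?R y) = (C\<^sup>2 + T\<^sup>2) * (x$1 * y$1 + x$2 * y$2) + (C'\<^sup>2 + T'\<^sup>2) * (x$3 * y$3 + x$4 * y$4)"
      by (simp add: inner_vec_def sum_4 algebra_simps power2_eq_square)
    then show "inner (?R x) (?R y) = inner x y"
      by (simp add: assms inner_vec_def sum_4)
  qed
  moreover have "torus_vec a b c d (C * p - T * q) (T * p + C * q) (C' * r - T' * s) (T' * r + C' * s) x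
      = ?R (torus_vec a b c d p q r s x)" for x
    by (simp add: torus_vec_def Let_def vec_eq_iff forall_4 algebra_simps)
  ultimately show ?thesis unfolding congruent_maps_def by blast
qed

lemma torus_map_structure:
  assumes adm: "admissible r s \<phi> \<theta>" and coord: "complex_coordinate S z"
    and p: "p = (r\<^sup>2 - s\<^sup>2) * (sinh (2 * \<phi>))\<^sup>2 / (r * s)"
    and q: "q = sinh (2 * \<phi>) * sqrt (1 - (r\<^sup>2 - s\<^sup>2)\<^sup>2 * (cosh (2 * \<phi>))\<^sup>2) / (r * s)"
    and k: "k = 4 * (sinh \<phi>)\<^sup>2"
  defines "a \<equiv> 2 / r * sinh \<phi> * cos \<theta>" and "b \<equiv> - (2 / r) * cosh \<phi> * sin \<theta>"
    and "c \<equiv> 2 / s * sinh \<phi> * sin \<theta>" and "d \<equiv> 2 / s * cosh \<phi> * cos \<theta>"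
  shows "structure_equations S z k (k + 4) p q (\<lambda>x. torus_map r s \<phi> \<theta> (z x))
     (\<lambda>x. torus_vec a b c d 0 (a * r) 0 (c * s) (z x))
     (\<lambda>x. torus_vec a b c d 0 (b * r) 0 (d * s) (z x)) (\<lambda>x. torus_vec a b c d s 0 (- r) 0 (z x))"
proof -
  note t = admissible_torus[OF adm, folded a_def b_def c_def d_def]
  have "r\<^sup>2 + s\<^sup>2 = 1" "\<phi> > 0" using adm by (auto simp: admissible_def)
  moreover have "k + 4 = 4 * (cosh \<phi>)\<^sup>2" by (simp add: k cosh_square_eq)
  ultimately show ?thesis
    unfolding torus_map_eq a_def[symmetric] b_def[symmetric] c_def[symmetric] d_def[symmetric]
    by (intro torus_vec_structure coord) (use t p q k in auto)
qed

lemma torus_map_properties: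
  assumes adm: "admissible r s \<phi> \<theta>"
  defines "f \<equiv> torus_map r s \<phi> \<theta>" and "z \<equiv> \<lambda>w :: complex. w"
  shows "harmonic_map UNIV z f" "adapted_coordinate UNIV z f" "alpha_of UNIV z f w \<noteq> 0"
    "phi_of UNIV z f w = \<phi>"
    "inner (dx UNIV z f w) (dx UNIV z f w) = 4 * (sinh \<phi>)\<^sup>2"
    "inner (dy UNIV z f w) (dy UNIV z f w) = 4 * (cosh \<phi>)\<^sup>2"
    "mu_of UNIV z f w =
              complex_of_real (sinh (2 * \<phi>) / (2 * r * s)) *
              (complex_of_real ((r\<^sup>2 - s\<^sup>2) * sinh (2 * \<phi>))
               - \<i> * complex_of_real (sqrt (1 - (r\<^sup>2 - s\<^sup>2)\<^sup>2 * (cosh (2 * \<phi>))\<^sup>2)))"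
    "\<epsilon>\<^sup>2 = 1 \<Longrightarrow> congruent_maps UNIV f (eps_transform \<epsilon> UNIV z f)"
proof -
  define a where "a = 2 / r * sinh \<phi> * cos \<theta>"
  define b where "b = - (2 / r) * cosh \<phi> * sin \<theta>"
  define c where "c = 2 / s * sinh \<phi> * sin \<theta>"
  define d where "d = 2 / s * cosh \<phi> * cos \<theta>"
  note defs = a_def b_def c_def d_def
  note t = admissible_torus[OF adm, folded defs]
  have nz: "r \<noteq> 0" "s \<noteq> 0" and rs: "r\<^sup>2 + s\<^sup>2 = 1" and \<phi>: "\<phi> > 0"
    using adm by (auto simp: admissible_def)
  have coord: "complex_coordinate UNIV z" unfolding z_def by (rule complex_coordinate_plane)
  have zz: "z w = w" for w by (simp add: z_def)
  have f: "f = torus_vec a b c d r 0 s 0" unfolding f_def torus_map_eq defs ..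
  define u where "u = torus_vec a b c d 0 (a * r) 0 (c * s)"
  define v where "v = torus_vec a b c d 0 (b * r) 0 (d * s)"
  define n where "n = torus_vec a b c d s 0 (- r) 0"
  define k where "k = 4 * (sinh \<phi>)\<^sup>2"
  define p where "p = (r\<^sup>2 - s\<^sup>2) * (sinh (2 * \<phi>))\<^sup>2 / (r * s)"
  define q where "q = sinh (2 * \<phi>) * sqrt (1 - (r\<^sup>2 - s\<^sup>2)\<^sup>2 * (cosh (2 * \<phi>))\<^sup>2) / (r * s)"
  have k4: "k + 4 = 4 * (cosh \<phi>)\<^sup>2" by (simp add: k_def cosh_square_eq)
  have st: "structure_equations UNIV z k (k + 4) p q f u v n"
    using torus_map_structure[OF adm coord p_def q_def k_def]
    by (simp add: zz f_def u_def v_def n_def defs)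
  have smooth: "smooth_map UNIV z f"
    unfolding smooth_map_def f z_def using Ck_map_torus_vec by blast
  show "harmonic_map UNIV z f" "adapted_coordinate UNIV z f"
    using structure_equations_harmonic[OF coord st smooth] by auto
  have hf: "has_partials UNIV z f w (u w) (v w)" and fr: "orthogonal_frame (f w) (u w) (v w) (n w)"
    and ii: "inner (f w) (f w) = 1" "inner (u w) (u w) = k" "inner (v w) (v w) = k + 4" for w
    using st by (auto simp: structure_equations_def)
  have fo: "inner (f w) (u w) = 0" "inner (f w) (v w) = 0" for w
    using fr[of w] by (auto simp: orthogonal_frame_def)
  show "inner (dx UNIV z f w) (dx UNIV z f w) = 4 * (sinh \<phi>)\<^sup>2"
    "inner (dy UNIV z f w) (dy UNIV z f w) = 4 * (cosh \<phi>)\<^sup>2"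
    by (simp_all add: has_partials_dx[OF hf] has_partials_dy[OF hf] ii k4) (simp add: k_def)
  note ab = alpha_beta_of[OF hf ii(1) fo]
  have nu: "norm (u w) = 2 * sinh \<phi>" "norm (v w) = 2 * cosh \<phi>" for w
    using \<phi> unfolding norm_eq_sqrt_inner ii k4 unfolding k_def
    by (simp_all add: real_sqrt_mult)
  show "alpha_of UNIV z f w \<noteq> 0"
    using ab(3)[of w] nu(1)[of w] \<phi> by auto
  have phi: "phi_of UNIV z f w = \<phi>" for w
    using ab nu \<phi> by (intro phi_of_eqI) auto
  then show "phi_of UNIV z f w = \<phi>" .
  \<comment> \<open>The factor is positive, so \<open>n\<close> is the oriented normal and not its
    negative; the sign of \<mu> depends on this.\<close>
  have tc: "triple_cross (f w) (u w) (v w) = (2 * sinh (2 * \<phi>)) *\<^sub>R n w" for w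
    unfolding f u_def v_def n_def triple_cross_torus_vec[OF rs] t ..
  have "normal_of UNIV z f w = n w" for w
    using \<phi> unfolding normal_of_def phi ab(5) tc by simp
  then have mu: "mu_of UNIV z f w = (of_real p - \<i> * of_real q) / 2"
    by (intro structure_equations_mu_of[OF coord st]) auto
  have *: "(of_real (x * y\<^sup>2 / (r * s)) - \<i> * of_real (y * t / (r * s))) / 2
      = complex_of_real (y / (2 * r * s)) * (of_real (x * y) - \<i> * of_real t)" for x y t
    using nz by (simp add: complex_eq_iff power2_eq_square mult_ac)
  show "mu_of UNIV z f w =
              complex_of_real (sinh (2 * \<phi>) / (2 * r * s)) *
              (complex_of_real ((r\<^sup>2 - s\<^sup>2) * sinh (2 * \<phi>))
               - \<i> * complex_of_real (sqrt (1 - (r\<^sup>2 - s\<^sup>2)\<^sup>2 * (cosh (2 * \<phi>))\<^sup>2)))"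
    unfolding mu p_def q_def by (rule *)
  assume e: "\<epsilon>\<^sup>2 = 1"
  define m where "m = 1 / (2 * (cosh \<phi>)\<^sup>2)"
  have m: "4 * (cosh \<phi>)^4 * m\<^sup>2 = 1"
    by (simp add: m_def power_divide power_mult_distrib)
  define H where "H = sinh (2 * \<phi>)"
  \<comment> \<open>The transform is \<open>m\<close> times \<epsilon> v + H n, so its slots are
    those of \<open>f\<close> multiplied by m (s H / r + i \<epsilon> b) and m (- r H / s + i
    \<epsilon> d). The zero terms are kept to match \<open>torus_vec_rotate\<close>.\<close>
  have "eps_transform \<epsilon> UNIV z f w = torus_vec a b c d
      (m * (s * H / r) * r - m * \<epsilon> * b * 0) (m * \<epsilon> * b * r + m * (s * H / r) * 0)
      (m * (- (r * H / s)) * s - m * \<epsilon> * d * 0) (m * \<epsilon> * d * s + m * (- (r * H / s)) * 0) w" for w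
    unfolding eps_transform_eq[OF hf ii(1) fo] phi tc m_def[symmetric] H_def[symmetric]
    unfolding v_def n_def
    using nz by (simp add: torus_vec_linear algebra_simps)
  moreover have "(m * (s * H / r))\<^sup>2 + (m * \<epsilon> * b)\<^sup>2 = 1"
  proof -
    have "r\<^sup>2 * ((m * (s * H / r))\<^sup>2 + (m * \<epsilon> * b)\<^sup>2) = m\<^sup>2 * ((b * r)\<^sup>2 + s\<^sup>2 * H\<^sup>2)"
      using nz by (simp add: power_mult_distrib power_divide e algebra_simps)
    also have "\<dots> = r\<^sup>2" unfolding H_def t using m by (simp add: algebra_simps)
    finally show ?thesis using nz by simp
  qed
  moreover have "(m * (- (r * H / s)))\<^sup>2 + (m * \<epsilon> * d)\<^sup>2 = 1"
  proof -
    have "s\<^sup>2 * ((m * (- (r * H / s)))\<^sup>2 + (m * \<epsilon> * d)\<^sup>2) = m\<^sup>2 * ((d * s)\<^sup>2 + r\<^sup>2 * H\<^sup>2)"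
      using nz by (simp add: power_mult_distrib power_divide e algebra_simps)
    also have "\<dots> = s\<^sup>2" unfolding H_def t using m by (simp add: algebra_simps)
    finally show ?thesis using nz by simp
  qed
  ultimately show "congruent_maps UNIV f (eps_transform \<epsilon> UNIV z f)"
    using torus_vec_rotate[of "m * (s * H / r)" "m * \<epsilon> * b" "m * (- (r * H / s))" "m * \<epsilon> * d" UNIV a b c d r 0 s 0 "\<lambda>w. w"]
    unfolding f[symmetric] congruent_maps_def by simp
qed

lemma self_congruent_imp_torus_map:
  assumes coord: "complex_coordinate S z" and conn: "connected S"
    and harm: "harmonic_map S z f" and adapted: "adapted_coordinate S z f"
    and alpha: "\<And>p. p \<in> S \<Longrightarrow> alpha_of S z f p \<noteq> 0"
    and e: "\<epsilon>\<^sup>2 = 1" and cong: "congruent_maps S f (eps_transform \<epsilon> S z f)"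
  shows "\<exists>r s \<phi> \<theta>. admissible r s \<phi> \<theta> \<and> congruent_maps S (\<lambda>p. torus_map r s \<phi> \<theta> (z p)) f"
proof (cases "S = {}")
  case True
  \<comment> \<open>On the empty surface any admissible parameters serve; the values satisfy 5 + 0 =
    1 * (1 + 4).\<close>
  obtain r s \<phi> \<theta> where "admissible r s \<phi> \<theta>"
    using admissible_exists[of 1 "sqrt 5" 0] by auto
  then show ?thesis
    using True orthogonal_transformation_id unfolding congruent_maps_def by blast
next
  case False
  define u where "u = dx S z f"
  define v where "v = dy S z f"
  define ux where "ux = dx S z u"
  define uy where "uy = dy S z u"
  define vx where "vx = dx S z v"
  define vy where "vy = dy S z v"
  have "Ck_map (Suc (Suc 0)) S z f" 
    using harm unfolding harmonic_map_def smooth_map_def by blast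
  then have hf: "has_partials S z f p (u p) (v p)" and hu: "has_partials S z u p (ux p) (uy p)"
    and hv: "has_partials S z v p (vx p) (vy p)" if "p \<in> S" for p
    using that unfolding u_def v_def ux_def uy_def vx_def vy_def
    by (auto intro!: differentiable_has_partials)
  have ff: "inner (f p) (f p) = 1" if "p \<in> S" for p
    using harm that by (auto simp: harmonic_map_def norm_eq_1)
  have fu: "inner (f p) (u p) = 0" and fv: "inner (f p) (v p) = 0" if p: "p \<in> S" for p
    using inner_const_partials[OF coord hf[OF p] hf[OF p] p ff] by (auto simp: inner_commute)
  have uv: "inner (u p) (v p) = 0" and vv: "inner (v p) (v p) = inner (u p) (u p) + 4" if p: "p \<in> S" for p
    using adapted p cbilin_del(1)[OF hf[OF p]] by (auto simp: adapted_coordinate_def complex_eq_iff)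
  \<comment> \<open>The real part of the harmonic map equation is the equation for f_xx + f_yy;
    since f is real, its imaginary part is the symmetry of the mixed derivatives.\<close>
  have second: "ux p + vy p = - (inner (u p) (u p) + inner (v p) (v p)) *\<^sub>R f p \<and> vx p = uy p" if p: "p \<in> S" for p
  proof -
    have d: "dz S z (delbar S z f) p = (1/4) *s (cvec (ux p) + \<i> *s cvec (vx p) - \<i> *s cvec (uy p) + cvec (vy p))"
      by (rule dz_del_delbar(2)[OF coord _ p hu[OF p] hv[OF p]]) (rule hf)
    have h: "dz S z (delbar S z f) p = - (cbilin (del S z f p) (delbar S z f p) *s cvec (f p))"
      using harm p by (simp add: harmonic_map_def)
    have "(ux p + vy p) $ i = (- (inner (u p) (u p) + inner (v p) (v p)) *\<^sub>R f p) $ i \<and> vx p $ i = uy p $ i" for i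
    proof -
      have "(ux p $ i + vy p $ i) / 4 = - ((inner (u p) (u p) + inner (v p) (v p)) / 4 * f p $ i)"
        using arg_cong[OF h, of "\<lambda>x. Re (x $ i)"] unfolding d cbilin_del(2)[OF hf[OF p]]
        by (simp add: cvec_def add_divide_distrib distrib_right)
      moreover have "(vx p $ i - uy p $ i) / 4 = 0"
        using arg_cong[OF h, of "\<lambda>x. Im (x $ i)"] unfolding d cbilin_del(2)[OF hf[OF p]]
        by (simp add: cvec_def)
      ultimately show ?thesis by (simp add: algebra_simps)
    qed
    then show ?thesis by (simp add: vec_eq_iff)
  qed
  note ab = alpha_beta_of[OF hf ff fu fv]
  have u0: "u p \<noteq> 0" if "p \<in> S" for p
    using alpha[OF that] ab(3)[OF that that that that] by auto
  obtain R where R: "orthogonal_transformation R" and Rf: "\<And>p. p \<in> S \<Longrightarrow> R (f p) = eps_transform \<epsilon> S z f p"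
    using cong by (auto simp: congruent_maps_def)
  \<comment> \<open>This removes \<phi> from the transform: its leading factor becomes 2 / |f_y|^2.
    The candidate for \<open>phi_of\<close> comes from |f_x|, and |f_y|^2 = |f_x|^2 + 4 confirms the
    second norm.\<close>
  have cosh2: "4 * (cosh (phi_of S z f p))\<^sup>2 = inner (v p) (v p)" if p: "p \<in> S" for p
  proof -
    define t where "t = arsinh (norm (u p) / 2)"
    have t0: "t \<ge> 0" by (rule sinh_real_nonneg_iff[THEN iffD1]) (simp add: t_def)
    have sh: "norm (u p) = 2 * sinh t" by (simp add: t_def)
    have c4: "4 * (cosh t)\<^sup>2 = inner (v p) (v p)"
      using vv[OF p] by (simp add: dot_square_norm sh cosh_square_eq power_mult_distrib)
    have "norm (v p) = sqrt ((2 * cosh t)\<^sup>2)"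
      unfolding norm_eq_sqrt_inner c4[symmetric] by (simp add: power_mult_distrib)
    also have "\<dots> = 2 * cosh t" by (rule real_sqrt_unique) simp_all
    finally have ch: "norm (v p) = 2 * cosh t" .
    have "phi_of S z f p = t"
      using ab[OF p p p p] sh ch t0 by (intro phi_of_eqI) auto
    then show ?thesis using c4 by simp
  qed
  have Re: "R (f p) = (2 / inner (v p) (v p)) *\<^sub>R (\<epsilon> *\<^sub>R v p + (1/2) *\<^sub>R triple_cross (f p) (u p) (v p))"
    if p: "p \<in> S" for p
    unfolding Rf[OF p] eps_transform_eq[OF hf[OF p] ff[OF p] fu[OF p] fv[OF p]] cosh2[OF p, symmetric]
    by simp
  have vpos: "inner (v p) (v p) > 0" if p: "p \<in> S" for p
    using vv[OF p] by (simp add: add_nonneg_pos)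
  have RR: "inner (R (f p)) (f p) = 0" "inner (R (f p)) (u p) = 0" "inner (R (f p)) (v p) = 2 * \<epsilon>"
    if p: "p \<in> S" for p
    using vpos[OF p] fv[OF p, unfolded inner_commute[of "f p"]] uv[OF p, unfolded inner_commute[of "u p"]]
    by (simp_all add: Re[OF p] inner_add_left inner_triple_cross)
  have hu': "has_partials S z u p (ux p) (vx p)" if "p \<in> S" for p
    using hu[OF that] second[OF that] by simp
  have "\<exists>k a b n. a\<^sup>2 + b\<^sup>2 = k * (k + 4) \<and> structure_equations S z k (k + 4) a b f u v n"
    by (rule self_transform_structure[where ux = ux and w = vx and vy = vy and R = R and \<epsilon> = \<epsilon>])
       (use coord conn False hf hu' hv ff uv vv u0 second R e RR in auto)
  then obtain k a b n where kab: "a\<^sup>2 + b\<^sup>2 = k * (k + 4)"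
    and st: "structure_equations S z k (k + 4) a b f u v n"
    by blast
  have k: "k > 0" using st by (simp add: structure_equations_def)
  obtain r s \<phi> \<theta> where adm: "admissible r s \<phi> \<theta>" and kab': "k = 4 * (sinh \<phi>)\<^sup>2"
     "a = (r\<^sup>2 - s\<^sup>2) * (sinh (2 * \<phi>))\<^sup>2 / (r * s)"
     "b = sinh (2 * \<phi>) * sqrt (1 - (r\<^sup>2 - s\<^sup>2)\<^sup>2 * (cosh (2 * \<phi>))\<^sup>2) / (r * s)"
    using admissible_exists[OF k kab] by blast
  have "congruent_maps S (\<lambda>p. torus_map r s \<phi> \<theta> (z p)) f"
    by (rule congruent_maps_structure[OF coord conn st torus_map_structure[OF adm coord kab'(2,3,1)]])
  then show ?thesis using adm by blast
qed

theorem theorem4p4: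
  shows
    "(\<forall>r s \<phi> \<theta>. admissible r s \<phi> \<theta> \<longrightarrow>
        (let f = torus_map r s \<phi> \<theta>; P = (UNIV :: complex set); z = (\<lambda>w. w) in
           harmonic_map P z f \<and> non_conformal P z f \<and> adapted_coordinate P z f \<and>
           (\<forall>w. alpha_of P z f w \<noteq> 0) \<and>
           (\<forall>w. phi_of P z f w = \<phi>) \<and>
           (\<forall>w. inner (dx P z f w) (dx P z f w) = 4 * (sinh \<phi>)\<^sup>2) \<and>
           (\<forall>w. inner (dy P z f w) (dy P z f w) = 4 * (cosh \<phi>)\<^sup>2) \<and>
           (\<forall>w. mu_of P z f w =
              complex_of_real (sinh (2 * \<phi>) / (2 * r * s)) *
              (complex_of_real ((r\<^sup>2 - s\<^sup>2) * sinh (2 * \<phi>))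
               - \<i> * complex_of_real (sqrt (1 - (r\<^sup>2 - s\<^sup>2)\<^sup>2 * (cosh (2 * \<phi>))\<^sup>2)))) \<and>
           (\<forall>\<epsilon>\<in>{1, -1}. congruent_maps P f (eps_transform \<epsilon> P z f))))
     \<and>
     (\<forall>(S :: 'a::t2_space set) z f. \<forall>\<epsilon>\<in>{1, -1}.
        connected S \<and> complex_coordinate S z \<and>
        harmonic_map S z f \<and> non_conformal S z f \<and> adapted_coordinate S z f \<and>
        (\<forall>p\<in>S. alpha_of S z f p \<noteq> 0) \<and>
        congruent_maps S f (eps_transform \<epsilon> S z f) \<longrightarrow>
        (\<exists>r s \<phi> \<theta>. admissible r s \<phi> \<theta> \<and>
           congruent_maps S (\<lambda>p. torus_map r s \<phi> \<theta> (z p)) f))"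
proof (intro conjI allI ballI impI, goal_cases)
  case (1 r s \<phi> \<theta>)
  note t = torus_map_properties[OF 1]
  have "non_conformal UNIV (\<lambda>w. w) (torus_map r s \<phi> \<theta>)"
    using t(2) by (simp add: adapted_coordinate_def non_conformal_def)
  then show ?case
    unfolding Let_def using t by auto
next
  case (2 S z f \<epsilon>)
  then have "\<epsilon>\<^sup>2 = 1" by auto
  with 2 show ?case
    by (intro self_congruent_imp_torus_map[where \<epsilon> = \<epsilon>]) auto
qed

end
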